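(* Let $M^{2n+1}(f,Q,\xi,\eta,g)$ be a weak $\beta$-Kenmotsu manifold with $\beta=\mathrm{const}\neq0$, and suppose that $g$ is a $\ast$-$\eta$-Ricci soliton, i.e. $\tfrac12\pounds_V g+\mathrm{Ric}^\ast=\lambda\,g+\mu\,\eta\otimes\eta$ with $\lambda,\mu\in\mathbb R$, whose potential vector field $V$ is collinear with $\xi$: $V=\delta\,\xi$ for a smooth function $\delta\neq0$ on $M$. Then $\delta=\mathrm{const}$ and $(M,g)$ is an Einstein manifold of scalar curvature $r=-2n(2n+1)\beta^2$.
   Context: Manifolds are connected. A weak almost contact metric structure on a smooth manifold $M^{2n+1}$ (of dimension $2n+1$, $n\ge 1$) is a set $(f,Q,\xi,\eta,g)$, where $f$ is a $(1,1)$-tensor of rank $2n$, $Q$ is a nonsingular $(1,1)$-tensor, $\xi$ is a vector field, $\eta$ is a 1-form and $g$ is a Riemannian metric, such that $f^2=-Q+\eta\otimes\xi$, $\eta(\xi)=1$, $Q\xi=\xi$ and $g(fX,fY)=g(X,QY)-\eta(X)\eta(Y)$ for all vector fields $X,Y$. It is assumed that the distribution $\mathcal D=\ker\eta$ is $f$-invariant. $M(f,Q,\xi,\eta,g)$ is a weak $\beta$-Kenmotsu manifold (here $\beta$ is a nonzero real constant) if $(\nabla_X f)Y=\beta\{g(fX,Y)\,\xi-\eta(Y)\,fX\}$ for all vector fields $X,Y$, where $\nabla$ is the Levi-Civita connection of $g$. Curvature conventions: $R_{X,Y}Z=\nabla_X\nabla_YZ-\nabla_Y\nabla_XZ-\nabla_{[X,Y]}Z$;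 $\mathrm{Ric}(X,Y)=\mathrm{trace}(Z\mapsto R_{Z,X}Y)$; $r=\mathrm{trace}_g\mathrm{Ric}$. The $\ast$-Ricci tensor is $\mathrm{Ric}^\ast(X,Y)=\tfrac12\,\mathrm{trace}\{Z\mapsto R_{X,fY}fZ\}$. $\pounds$ denotes the Lie derivative. $(M,g)$ is Einstein if $\mathrm{Ric}$ is a constant multiple of $g$. *)

theory Defs
  imports "HOL-Analysis.Analysis"
begin

section \<open>Smooth maps between Euclidean spaces\<close>

text \<open>
  \<open>Ck_on k h S\<close> is meant for open \<open>S\<close> and a finite-dimensional domain: \<open>h\<close> is of class
  \<open>C\<^sup>k\<^sup>+\<^sup>1\<close> iff it is differentiable and all its directional derivatives are of class \<open>C\<^sup>k\<close>.
\<close>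

primrec Ck_on :: "nat \<Rightarrow> ('e::euclidean_space \<Rightarrow> 'b::real_normed_vector) \<Rightarrow> 'e set \<Rightarrow> bool" where
  "Ck_on 0 h S \<longleftrightarrow> continuous_on S h"
| "Ck_on (Suc k) h S \<longleftrightarrow>
     (\<forall>x\<in>S. h differentiable (at x)) \<and> (\<forall>v. Ck_on k (\<lambda>x. frechet_derivative h (at x) v) S)"

definition smooth_on :: "'e::euclidean_space set \<Rightarrow> ('e \<Rightarrow> 'b::real_normed_vector) \<Rightarrow> bool" where
  "smooth_on S h \<longleftrightarrow> (\<forall>k. Ck_on k h S)"


section \<open>Smooth manifolds\<close>

text \<open>
  The underlying space of the manifold is the whole type \<open>'m\<close>; the model space \<open>'e\<close> carries the
  dimension. A chart is a pair (domain, coordinate map).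
\<close>

type_synonym ('m, 'e) chart = "'m set \<times> ('m \<Rightarrow> 'e)"

definition chart_inv :: "('m, 'e) chart \<Rightarrow> 'e \<Rightarrow> 'm" where
  "chart_inv c = inv_into (fst c) (snd c)"

definition chart_image :: "('m, 'e) chart \<Rightarrow> 'e set" where
  "chart_image c = snd c ` fst c"

definition is_chart ::
  "('m::topological_space, 'e::euclidean_space) chart \<Rightarrow> bool" where
  "is_chart c \<longleftrightarrow> open (fst c) \<and> open (chart_image c) \<and>
     homeomorphism (fst c) (chart_image c) (snd c) (chart_inv c)"

definition smooth_atlas ::
  "('m::topological_space, 'e::euclidean_space) chart set \<Rightarrow> bool" where
  "smooth_atlas A \<longleftrightarrow>
     (\<forall>c\<in>A. is_chart c) \<and> (\<Union>c\<in>A. fst c) = UNIV \<and>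
     (\<forall>c\<in>A. \<forall>d\<in>A. smooth_on (snd c ` (fst c \<inter> fst d)) (snd d \<circ> chart_inv c))"

definition connected_manifold ::
  "nat \<Rightarrow> ('m::{t2_space, second_countable_topology}, 'e::euclidean_space) chart set \<Rightarrow> bool" where
  "connected_manifold m A \<longleftrightarrow>
     DIM('e) = m \<and> smooth_atlas A \<and> connected (UNIV :: 'm set)"

definition smooth_function ::
  "('m, 'e::euclidean_space) chart set \<Rightarrow> ('m \<Rightarrow> real) \<Rightarrow> bool" where
  "smooth_function A h \<longleftrightarrow> (\<forall>c\<in>A. smooth_on (chart_image c) (h \<circ> chart_inv c))"


section \<open>Tangent vectors and tensor fields\<close>

text \<open>
  At every point \<open>p\<close> one chart \<open>chart_at A p\<close> of the atlas is chosen once and for all, and the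
  tangent space at \<open>p\<close> is identified with \<open>'e\<close> through it: \<open>v :: 'e\<close> stands for
  the tangent vector with components \<open>v\<close> in that chart. Since \<open>chart_at A p\<close> varies
  discontinuously with \<open>p\<close>, smoothness of a vector field \<open>X :: 'm \<Rightarrow> 'e\<close> is not smoothness
  as an \<open>'e\<close>-valued map, but smoothness of its components \<open>in_chart A c X\<close> in the charts \<open>c\<close>.
\<close>

definition chart_at :: "('m, 'e) chart set \<Rightarrow> 'm \<Rightarrow> ('m, 'e) chart" where
  "chart_at A p = (SOME c. c \<in> A \<and> p \<in> fst c)"

definition differential ::
  "('m, 'e::euclidean_space) chart set \<Rightarrow> ('m \<Rightarrow> 'b::real_normed_vector) \<Rightarrow> 'm \<Rightarrow> 'e \<Rightarrow> 'b" where
  "differential A h p v =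
     frechet_derivative (h \<circ> chart_inv (chart_at A p)) (at (snd (chart_at A p) p)) v"

definition in_chart ::
  "('m, 'e::euclidean_space) chart set \<Rightarrow> ('m, 'e) chart \<Rightarrow> ('m \<Rightarrow> 'e) \<Rightarrow> 'e \<Rightarrow> 'e" where
  "in_chart A c X u = differential A (snd c) (chart_inv c u) (X (chart_inv c u))"

definition vector_field ::
  "('m, 'e::euclidean_space) chart set \<Rightarrow> ('m \<Rightarrow> 'e) \<Rightarrow> bool" where
  "vector_field A X \<longleftrightarrow> (\<forall>c\<in>A. smooth_on (chart_image c) (in_chart A c X))"

text \<open>The derivative \<open>X h\<close> of a function along a vector field.\<close>

definition deriv_along ::
  "('m, 'e::euclidean_space) chart set \<Rightarrow> ('m \<Rightarrow> 'e) \<Rightarrow> ('m \<Rightarrow> real) \<Rightarrow> 'm \<Rightarrow> real" where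
  "deriv_along A X h p = differential A h p (X p)"

text \<open>
  In coordinates \<open>[X, Y] = DY X - DX Y\<close>, i.e. \<open>[X, Y] h = X (Y h) - Y (X h)\<close>. Evaluated at
  \<open>p\<close> in the chart \<open>chart_at A p\<close>, where the components of \<open>X\<close> at \<open>p\<close> are \<open>X p\<close> itself.
\<close>

definition lie_bracket ::
  "('m, 'e::euclidean_space) chart set \<Rightarrow> ('m \<Rightarrow> 'e) \<Rightarrow> ('m \<Rightarrow> 'e) \<Rightarrow> 'm \<Rightarrow> 'e" where
  "lie_bracket A X Y p =
     (let c = chart_at A p; u = snd c p in
        frechet_derivative (in_chart A c Y) (at u) (X p)
      - frechet_derivative (in_chart A c X) (at u) (Y p))"

definition one_form ::
  "('m, 'e::euclidean_space) chart set \<Rightarrow> ('m \<Rightarrow> 'e \<Rightarrow> real) \<Rightarrow> bool" where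
  "one_form A \<omega> \<longleftrightarrow> (\<forall>p. linear (\<omega> p)) \<and>
     (\<forall>X. vector_field A X \<longrightarrow> smooth_function A (\<lambda>p. \<omega> p (X p)))"

definition tensor_11 ::
  "('m, 'e::euclidean_space) chart set \<Rightarrow> ('m \<Rightarrow> 'e \<Rightarrow> 'e) \<Rightarrow> bool" where
  "tensor_11 A T \<longleftrightarrow> (\<forall>p. linear (T p)) \<and>
     (\<forall>X. vector_field A X \<longrightarrow> vector_field A (\<lambda>p. T p (X p)))"

definition riemannian_metric ::
  "('m, 'e::euclidean_space) chart set \<Rightarrow> ('m \<Rightarrow> 'e \<Rightarrow> 'e \<Rightarrow> real) \<Rightarrow> bool" where
  "riemannian_metric A g \<longleftrightarrow>
     (\<forall>p. bilinear (g p)) \<and>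
     (\<forall>p u v. g p u v = g p v u) \<and>
     (\<forall>p v. v \<noteq> 0 \<longrightarrow> g p v v > 0) \<and>
     (\<forall>X Y. vector_field A X \<longrightarrow> vector_field A Y \<longrightarrow>
        smooth_function A (\<lambda>p. g p (X p) (Y p)))"


section \<open>Connections, curvature and the Lie derivative of the metric\<close>

definition affine_connection ::
  "('m, 'e::euclidean_space) chart set \<Rightarrow> (('m \<Rightarrow> 'e) \<Rightarrow> ('m \<Rightarrow> 'e) \<Rightarrow> 'm \<Rightarrow> 'e) \<Rightarrow> bool" where
  "affine_connection A D \<longleftrightarrow>
     (\<forall>X Y. vector_field A X \<longrightarrow> vector_field A Y \<longrightarrow> vector_field A (D X Y)) \<and>
     (\<forall>X Y Z. vector_field A X \<longrightarrow> vector_field A Y \<longrightarrow> vector_field A Z \<longrightarrow>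
        D (\<lambda>p. X p + Y p) Z = (\<lambda>p. D X Z p + D Y Z p) \<and>
        D Z (\<lambda>p. X p + Y p) = (\<lambda>p. D Z X p + D Z Y p)) \<and>
     (\<forall>h X Y. smooth_function A h \<longrightarrow> vector_field A X \<longrightarrow> vector_field A Y \<longrightarrow>
        D (\<lambda>p. h p *\<^sub>R X p) Y = (\<lambda>p. h p *\<^sub>R D X Y p) \<and>
        D X (\<lambda>p. h p *\<^sub>R Y p) = (\<lambda>p. deriv_along A X h p *\<^sub>R Y p + h p *\<^sub>R D X Y p))"

text \<open>
  By the fundamental theorem of Riemannian geometry exactly one \<open>D\<close> satisfies this (as an
  operator on smooth vector fields).
\<close>

definition levi_civita ::
  "('m, 'e::euclidean_space) chart set \<Rightarrow> ('m \<Rightarrow> 'e \<Rightarrow> 'e \<Rightarrow> real)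
    \<Rightarrow> (('m \<Rightarrow> 'e) \<Rightarrow> ('m \<Rightarrow> 'e) \<Rightarrow> 'm \<Rightarrow> 'e) \<Rightarrow> bool" where
  "levi_civita A g D \<longleftrightarrow> affine_connection A D \<and>
     (\<forall>X Y. vector_field A X \<longrightarrow> vector_field A Y \<longrightarrow>
        (\<forall>p. D X Y p - D Y X p = lie_bracket A X Y p)) \<and>
     (\<forall>X Y Z. vector_field A X \<longrightarrow> vector_field A Y \<longrightarrow> vector_field A Z \<longrightarrow>
        (\<forall>p. deriv_along A X (\<lambda>q. g q (Y q) (Z q)) p
             = g p (D X Y p) (Z p) + g p (Y p) (D X Z p)))"

definition curvature ::
  "('m, 'e::euclidean_space) chart set \<Rightarrow> (('m \<Rightarrow> 'e) \<Rightarrow> ('m \<Rightarrow> 'e) \<Rightarrow> 'm \<Rightarrow> 'e)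
    \<Rightarrow> ('m \<Rightarrow> 'e) \<Rightarrow> ('m \<Rightarrow> 'e) \<Rightarrow> ('m \<Rightarrow> 'e) \<Rightarrow> 'm \<Rightarrow> 'e" where
  "curvature A D X Y Z p = D X (D Y Z) p - D Y (D X Z) p - D (lie_bracket A X Y) Z p"

text \<open>
  The value of the curvature on tangent vectors at \<open>p\<close>, through arbitrary extensions to global
  smooth vector fields. These exist (by bump functions) and the value does not depend on them,
  because the curvature is tensorial.
\<close>

definition extension ::
  "('m, 'e::euclidean_space) chart set \<Rightarrow> 'm \<Rightarrow> 'e \<Rightarrow> 'm \<Rightarrow> 'e" where
  "extension A p v = (SOME X. vector_field A X \<and> X p = v)"

definition curvature_at ::
  "('m, 'e::euclidean_space) chart set \<Rightarrow> (('m \<Rightarrow> 'e) \<Rightarrow> ('m \<Rightarrow> 'e) \<Rightarrow> 'm \<Rightarrow> 'e)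
    \<Rightarrow> 'm \<Rightarrow> 'e \<Rightarrow> 'e \<Rightarrow> 'e \<Rightarrow> 'e" where
  "curvature_at A D p u v w =
     curvature A D (extension A p u) (extension A p v) (extension A p w) p"

text \<open>
  The library's \<open>trace\<close> is for matrices; for a linear endomorphism the following does not
  depend on the basis.
\<close>

definition trace_endo :: "('e::euclidean_space \<Rightarrow> 'e) \<Rightarrow> real" where
  "trace_endo T = (\<Sum>b\<in>Basis. T b \<bullet> b)"

definition ricci ::
  "('m, 'e::euclidean_space) chart set \<Rightarrow> (('m \<Rightarrow> 'e) \<Rightarrow> ('m \<Rightarrow> 'e) \<Rightarrow> 'm \<Rightarrow> 'e)
    \<Rightarrow> 'm \<Rightarrow> 'e \<Rightarrow> 'e \<Rightarrow> real" where
  "ricci A D p u v = trace_endo (\<lambda>w. curvature_at A D p w u v)"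

definition star_ricci ::
  "('m, 'e::euclidean_space) chart set \<Rightarrow> (('m \<Rightarrow> 'e) \<Rightarrow> ('m \<Rightarrow> 'e) \<Rightarrow> 'm \<Rightarrow> 'e)
    \<Rightarrow> ('m \<Rightarrow> 'e \<Rightarrow> 'e) \<Rightarrow> 'm \<Rightarrow> 'e \<Rightarrow> 'e \<Rightarrow> real" where
  "star_ricci A D f p u v = (1/2) * trace_endo (\<lambda>w. curvature_at A D p u (f p v) (f p w))"

text \<open>The trace of a bilinear form \<open>B\<close> with respect to an inner product \<open>G\<close>: raise an index.\<close>

definition metric_trace ::
  "('e::euclidean_space \<Rightarrow> 'e \<Rightarrow> real) \<Rightarrow> ('e \<Rightarrow> 'e \<Rightarrow> real) \<Rightarrow> real" where
  "metric_trace G B = trace_endo (THE S. linear S \<and> (\<forall>u v. G (S u) v = B u v))"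

definition scalar_curvature ::
  "('m, 'e::euclidean_space) chart set \<Rightarrow> ('m \<Rightarrow> 'e \<Rightarrow> 'e \<Rightarrow> real)
    \<Rightarrow> (('m \<Rightarrow> 'e) \<Rightarrow> ('m \<Rightarrow> 'e) \<Rightarrow> 'm \<Rightarrow> 'e) \<Rightarrow> 'm \<Rightarrow> real" where
  "scalar_curvature A g D p = metric_trace (g p) (ricci A D p)"

definition einstein ::
  "('m, 'e::euclidean_space) chart set \<Rightarrow> ('m \<Rightarrow> 'e \<Rightarrow> 'e \<Rightarrow> real)
    \<Rightarrow> (('m \<Rightarrow> 'e) \<Rightarrow> ('m \<Rightarrow> 'e) \<Rightarrow> 'm \<Rightarrow> 'e) \<Rightarrow> bool" where
  "einstein A g D \<longleftrightarrow> (\<exists>a. \<forall>p u v. ricci A D p u v = a * g p u v)"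

definition lie_derivative_metric ::
  "('m, 'e::euclidean_space) chart set \<Rightarrow> ('m \<Rightarrow> 'e) \<Rightarrow> ('m \<Rightarrow> 'e \<Rightarrow> 'e \<Rightarrow> real)
    \<Rightarrow> ('m \<Rightarrow> 'e) \<Rightarrow> ('m \<Rightarrow> 'e) \<Rightarrow> 'm \<Rightarrow> real" where
  "lie_derivative_metric A V g X Y p =
     deriv_along A V (\<lambda>q. g q (X q) (Y q)) p
     - g p (lie_bracket A V X p) (Y p) - g p (X p) (lie_bracket A V Y p)"


section \<open>Weak almost contact metric structures\<close>

definition weak_almost_contact_metric ::
  "nat \<Rightarrow> ('m::{t2_space, second_countable_topology}, 'e::euclidean_space) chart set
    \<Rightarrow> ('m \<Rightarrow> 'e \<Rightarrow> 'e) \<Rightarrow> ('m \<Rightarrow> 'e \<Rightarrow> 'e) \<Rightarrow> ('m \<Rightarrow> 'e) \<Rightarrow> ('m \<Rightarrow> 'e \<Rightarrow> real)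
    \<Rightarrow> ('m \<Rightarrow> 'e \<Rightarrow> 'e \<Rightarrow> real) \<Rightarrow> bool" where
  "weak_almost_contact_metric n A f Q \<xi> \<eta> g \<longleftrightarrow>
     n \<ge> 1 \<and> connected_manifold (2 * n + 1) A \<and>
     tensor_11 A f \<and> (\<forall>p. dim (range (f p)) = 2 * n) \<and>
     tensor_11 A Q \<and> (\<forall>p. bij (Q p)) \<and>
     vector_field A \<xi> \<and> one_form A \<eta> \<and> riemannian_metric A g \<and>
     (\<forall>p v. f p (f p v) = - Q p v + \<eta> p v *\<^sub>R \<xi> p) \<and>
     (\<forall>p. \<eta> p (\<xi> p) = 1) \<and>
     (\<forall>p. Q p (\<xi> p) = \<xi> p) \<and>
     (\<forall>p u v. g p (f p u) (f p v) = g p u (Q p v) - \<eta> p u * \<eta> p v) \<and>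
     (\<forall>p v. \<eta> p v = 0 \<longrightarrow> \<eta> p (f p v) = 0)"

text \<open>The left-hand side of the last equation is \<open>(\<nabla>\<^sub>X f) Y = \<nabla>\<^sub>X (f Y) - f (\<nabla>\<^sub>X Y)\<close>.\<close>

definition weak_beta_kenmotsu ::
  "nat \<Rightarrow> real \<Rightarrow> ('m::{t2_space, second_countable_topology}, 'e::euclidean_space) chart set
    \<Rightarrow> ('m \<Rightarrow> 'e \<Rightarrow> 'e) \<Rightarrow> ('m \<Rightarrow> 'e \<Rightarrow> 'e) \<Rightarrow> ('m \<Rightarrow> 'e) \<Rightarrow> ('m \<Rightarrow> 'e \<Rightarrow> real)
    \<Rightarrow> ('m \<Rightarrow> 'e \<Rightarrow> 'e \<Rightarrow> real) \<Rightarrow> (('m \<Rightarrow> 'e) \<Rightarrow> ('m \<Rightarrow> 'e) \<Rightarrow> 'm \<Rightarrow> 'e) \<Rightarrow> bool" where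
  "weak_beta_kenmotsu n \<beta> A f Q \<xi> \<eta> g D \<longleftrightarrow>
     weak_almost_contact_metric n A f Q \<xi> \<eta> g \<and> levi_civita A g D \<and> \<beta> \<noteq> 0 \<and>
     (\<forall>X Y. vector_field A X \<longrightarrow> vector_field A Y \<longrightarrow>
        (\<forall>p. D X (\<lambda>q. f q (Y q)) p - f p (D X Y p)
             = \<beta> *\<^sub>R (g p (f p (X p)) (Y p) *\<^sub>R \<xi> p - \<eta> p (Y p) *\<^sub>R f p (X p))))"

definition star_eta_ricci_soliton ::
  "('m, 'e::euclidean_space) chart set \<Rightarrow> ('m \<Rightarrow> 'e \<Rightarrow> 'e) \<Rightarrow> ('m \<Rightarrow> 'e \<Rightarrow> real)
    \<Rightarrow> ('m \<Rightarrow> 'e \<Rightarrow> 'e \<Rightarrow> real) \<Rightarrow> (('m \<Rightarrow> 'e) \<Rightarrow> ('m \<Rightarrow> 'e) \<Rightarrow> 'm \<Rightarrow> 'e)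
    \<Rightarrow> ('m \<Rightarrow> 'e) \<Rightarrow> real \<Rightarrow> real \<Rightarrow> bool" where
  "star_eta_ricci_soliton A f \<eta> g D V lam mu \<longleftrightarrow> vector_field A V \<and>
     (\<forall>X Y. vector_field A X \<longrightarrow> vector_field A Y \<longrightarrow>
        (\<forall>p. (1/2) * lie_derivative_metric A V g X Y p + star_ricci A D f p (X p) (Y p)
             = lam * g p (X p) (Y p) + mu * (\<eta> p (X p) * \<eta> p (Y p))))"

end

theory Submission
  imports Defs
begin

text \<open>
  The structure determines the geometry in the direction of \<open>\<xi>\<close>. Evaluating the equation for
  \<open>\<nabla> f\<close> on \<open>\<xi>\<close> gives \<open>\<nabla>\<^sub>X \<xi> = \<beta> (X - \<eta>(X) \<xi>)\<close>, hence every curvature component with an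
  argument \<open>\<xi>\<close>, and the second Bianchi identity then gives the derivative of the whole curvature
  tensor along \<open>\<xi>\<close> (\<open>D_xi_curvature\<close>). Its contraction is

    \<open>(\<nabla>\<^sub>\<xi> Ric)(Y, Z) = - 2 \<beta> Ric(Y, Z) - 4 n \<beta>\<^sup>3 g(Y, Z)\<close>   (\<open>dv_xi_Ric\<close>).

  Independently, commuting \<open>f\<close> past the curvature expresses \<open>Ric\<^sup>*\<close> by \<open>Ric(\<cdot>, Q \<cdot>)\<close>, \<open>g(\<cdot>, Q \<cdot>)\<close> and
  \<open>\<eta> \<otimes> \<eta>\<close> (\<open>star_ricci_eq\<close>). For \<open>V = \<delta> \<xi>\<close> the soliton equation therefore says two things: its
  \<open>\<xi>\<close>-part is \<open>d\<delta> = (\<lambda> + \<mu>) \<eta>\<close>, and the rest expresses \<open>Ric(\<cdot>, Q \<cdot>)\<close> by \<open>g\<close>, \<open>\<eta>\<close>, \<open>Q\<close> and \<open>\<delta>\<close>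
  (\<open>Ric_Q\<close>).

  The proof differentiates this expression twice along \<open>\<xi>\<close>, using that \<open>Q\<close>, \<open>g\<close> and \<open>\<eta>\<close> are parallel
  in that direction. The first derivative, compared with \<open>dv_xi_Ric\<close>, shows that on \<open>ker \<eta>\<close> the
  endomorphism \<open>Q\<close> is a multiple of the identity, with a factor that is affine in \<open>\<delta>\<close>
  (\<open>Q_from_soliton\<close>). The second derivative shows that this factor does not change along \<open>\<xi>\<close>, so
  \<open>\<lambda> + \<mu> = \<xi>(\<delta>) = 0\<close>. Then \<open>d\<delta> = 0\<close>, and \<open>\<delta>\<close> is constant because \<open>M\<close> is connected; inserting the
  value of \<open>Q\<close> gives \<open>Ric(X, Q Y) = - 2 n \<beta>\<^sup>2 g(X, Q Y)\<close>, and \<open>Q\<close> is invertible.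
  Geometrically, \<open>M\<close> is locally a warped product of a line and a fibre with warping function
  \<open>e\<^sup>\<beta>\<^sup>t\<close>: the soliton equation equates \<open>e\<^sup>2\<^sup>\<beta>\<^sup>t\<close> times a tensor affine in \<open>t\<close> with a tensor of
  the fibre, and this is possible only if the affine tensor vanishes identically.

  These tensor computations need the curvature as a multilinear map on each tangent space, while it is
  defined through global vector fields. Bump functions built from \<open>e\<^sup>-\<^sup>1\<^sup>/\<^sup>t\<close> provide global fields
  with prescribed values and, around each point, global fields that form a frame (\<open>local_frame\<close>). From
  the frame follow the two facts that lead from fields to points: an expression that is linear over the
  smooth functions depends only on the value of the field at the point (\<open>tensorial\<close>), and covariant
  differentiation commutes with taking traces (\<open>dv_trace\<close>).
\<close>

section \<open>Calculus of smooth maps\<close>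

lemma Ck_on_cong:
  assumes "open S" "\<And>x. x \<in> S \<Longrightarrow> h x = h' x"
  shows "Ck_on k h S \<longleftrightarrow> Ck_on k h' S"
  using assms(2)
proof (induction k arbitrary: h h')
  case 0
  then show ?case by (simp cong: continuous_on_cong)
next
  case (Suc k)
  have hd: "(h has_derivative D) (at x) \<longleftrightarrow> (h' has_derivative D) (at x)" if "x \<in> S" for x D
    using has_derivative_transform_within_open[OF _ assms(1) that] Suc.prems by metis
  then have "h differentiable (at x) \<longleftrightarrow> h' differentiable (at x)"
    and "frechet_derivative h (at x) = frechet_derivative h' (at x)" if "x \<in> S" for x
    using that by (simp_all add: differentiable_def frechet_derivative_def)
  with Suc.IH[of "\<lambda>x. frechet_derivative h (at x) v" "\<lambda>x. frechet_derivative h' (at x) v" for v]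
  show ?case by auto
qed

lemma Ck_on_subset: "Ck_on k h S \<Longrightarrow> T \<subseteq> S \<Longrightarrow> Ck_on k h T"
  by (induction k arbitrary: h) (auto intro: continuous_on_subset)

lemma Ck_on_local:
  assumes "\<And>x. x \<in> S \<Longrightarrow> \<exists>T. open T \<and> x \<in> T \<and> Ck_on k h T"
  shows "Ck_on k h S"
  using assms
proof (induction k arbitrary: h)
  case 0
  have "continuous (at x) h" if "x \<in> S" for x
    using 0[OF that] by (auto simp: continuous_on_eq_continuous_at)
  then show ?case by (simp add: continuous_at_imp_continuous_on)
next
  case (Suc k)
  then show ?case by (simp; meson)
qed

lemma smooth_on_local:
  assumes "\<And>x. x \<in> S \<Longrightarrow> \<exists>T. open T \<and> x \<in> T \<and> smooth_on T h"
  shows "smooth_on S h"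
  unfolding smooth_on_def by (meson Ck_on_local assms smooth_on_def)

lemma smooth_on_subset: "smooth_on S h \<Longrightarrow> T \<subseteq> S \<Longrightarrow> smooth_on T h"
  by (auto simp: smooth_on_def intro: Ck_on_subset)

lemma Ck_on_SucD: "Ck_on (Suc k) h S \<Longrightarrow> Ck_on k h S"
proof (induction k arbitrary: h)
  case 0
  then show ?case
    by (auto intro!: continuous_at_imp_continuous_on differentiable_imp_continuous_within)
next
  case (Suc k)
  then show ?case by (metis Ck_on.simps(2))
qed

lemma Ck_on_SucI:
  assumes "open S" and "\<And>x. x \<in> S \<Longrightarrow> (h has_derivative h' x) (at x)"
    and "\<And>v. Ck_on k (\<lambda>x. h' x v) S"
  shows "Ck_on (Suc k) h S"
proof -
  have "frechet_derivative h (at x) = h' x" if "x \<in> S" for x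
    using assms(2)[OF that] frechet_derivative_at by metis
  moreover have "Ck_on k (\<lambda>x. frechet_derivative h (at x) v) S
      \<longleftrightarrow> Ck_on k (\<lambda>x. h' x v) S" for v
    by (rule Ck_on_cong[OF assms(1)]) (simp add: calculation)
  ultimately show ?thesis using assms by (auto simp: differentiable_def)
qed

lemma Ck_on_const: "Ck_on k (\<lambda>x. c) S"
  by (induction k arbitrary: c) auto

lemma Ck_on_bounded_linear:
  assumes "open S" "bounded_linear L" "Ck_on k h S"
  shows "Ck_on k (\<lambda>x. L (h x)) S"
  using assms(3)
proof (induction k arbitrary: h)
  case 0
  then show ?case using bounded_linear.continuous_on[OF assms(2)] by simp
next
  case (Suc k)
  show ?case
    by (rule Ck_on_SucI[OF assms(1), where h' = "\<lambda>x v. L (frechet_derivative h (at x) v)"])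
       (use Suc in \<open>auto intro!: bounded_linear.has_derivative[OF assms(2)]
          simp: frechet_derivative_works[symmetric]\<close>)
qed

lemma Ck_on_add:
  assumes "open S" "Ck_on k h S" "Ck_on k h' S"
  shows "Ck_on k (\<lambda>x. h x + h' x) S"
  using assms(2,3)
proof (induction k arbitrary: h h')
  case 0
  then show ?case by (simp add: continuous_on_add)
next
  case (Suc k)
  show ?case
    by (rule Ck_on_SucI[OF assms(1), where
          h' = "\<lambda>x v. frechet_derivative h (at x) v + frechet_derivative h' (at x) v"])
       (use Suc in \<open>auto intro!: has_derivative_add
          simp: frechet_derivative_works[symmetric]\<close>)
qed

lemma Ck_on_sum:
  assumes "open S" "\<And>i. i \<in> I \<Longrightarrow> Ck_on k (h i) S"
  shows "Ck_on k (\<lambda>x. \<Sum>i\<in>I. h i x) S"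
  using assms(2) by (induction I rule: infinite_finite_induct)
    (auto intro: Ck_on_const Ck_on_add[OF assms(1)])

lemma Ck_on_bilinear:
  assumes "open S" "bounded_bilinear B" "Ck_on k h S" "Ck_on k h' S"
  shows "Ck_on k (\<lambda>x. B (h x) (h' x)) S"
  using assms(3,4)
proof (induction k arbitrary: h h')
  case 0
  then show ?case using bounded_bilinear.continuous_on[OF assms(2)] by simp
next
  case (Suc k)
  note lower = Suc.prems[THEN Ck_on_SucD]
  show ?case
    by (rule Ck_on_SucI[OF assms(1), where h' = "\<lambda>x v. B (h x) (frechet_derivative h' (at x) v)
          + B (frechet_derivative h (at x) v) (h' x)"])
       (use Suc lower in \<open>auto intro!: bounded_bilinear.FDERIV[OF assms(2)] Ck_on_add[OF assms(1)]
          simp: frechet_derivative_works[symmetric]\<close>)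
qed

lemma frechet_derivative_Basis:
  fixes h :: "'e::euclidean_space \<Rightarrow> 'b::real_normed_vector"
  assumes "h differentiable (at x)"
  shows "frechet_derivative h (at x) v = (\<Sum>b\<in>Basis. (v \<bullet> b) *\<^sub>R frechet_derivative h (at x) b)"
proof -
  interpret linear "frechet_derivative h (at x)"
    using assms by (simp add: linear_frechet_derivative)
  have "frechet_derivative h (at x) v = frechet_derivative h (at x) (\<Sum>b\<in>Basis. (v \<bullet> b) *\<^sub>R b)"
    by (simp add: euclidean_representation)
  then show ?thesis by (simp add: sum scale)
qed

text \<open>
  By the chain rule, a directional derivative of \<open>h \<circ> \<phi>\<close> is a finite sum of products of
  directional derivatives of \<open>\<phi>\<close> with directional derivatives of \<open>h\<close> along basis vectors, composed
  with \<open>\<phi>\<close>. Expanding in the basis matters for the induction: the direction in which \<open>h\<close> is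
  differentiated must not vary with the point.
\<close>

lemma Ck_on_compose:
  fixes h :: "'e::euclidean_space \<Rightarrow> 'b::real_normed_vector"
    and \<phi> :: "'d::euclidean_space \<Rightarrow> 'e"
  assumes "open S" "open T" "Ck_on k \<phi> S" "Ck_on k h T" "\<phi> ` S \<subseteq> T"
  shows "Ck_on k (\<lambda>x. h (\<phi> x)) S"
  using assms(3,4)
proof (induction k arbitrary: h)
  case 0
  then show ?case using assms(5) continuous_on_compose2 by (metis Ck_on.simps(1))
next
  case (Suc k)
  show ?case
  proof (rule Ck_on_SucI[OF assms(1)])
    fix x assume x: "x \<in> S"
    have "(h has_derivative frechet_derivative h (at (\<phi> x))) (at (\<phi> x))"
      using x assms(5) Suc.prems(2) by (auto simp: frechet_derivative_works[symmetric])
    moreover have "(\<phi> has_derivative frechet_derivative \<phi> (at x)) (at x)"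
      using x Suc.prems(1) by (auto simp: frechet_derivative_works[symmetric])
    ultimately have "((\<lambda>x. h (\<phi> x)) has_derivative
        (\<lambda>v. frechet_derivative h (at (\<phi> x)) (frechet_derivative \<phi> (at x) v))) (at x)"
      by (rule has_derivative_compose[rotated])
    moreover have "h differentiable (at (\<phi> x))"
      using x assms(5) Suc.prems(2) by auto
    ultimately show "((\<lambda>x. h (\<phi> x)) has_derivative (\<lambda>v. \<Sum>b\<in>Basis.
        (frechet_derivative \<phi> (at x) v \<bullet> b) *\<^sub>R frechet_derivative h (at (\<phi> x)) b)) (at x)"
      by (subst (asm) frechet_derivative_Basis) auto
  next
    fix v
    show "Ck_on k (\<lambda>x. \<Sum>b\<in>Basis. (frechet_derivative \<phi> (at x) v \<bullet> b) *\<^sub>R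
        frechet_derivative h (at (\<phi> x)) b) S"
    proof (intro Ck_on_sum[OF assms(1)] Ck_on_bilinear[OF assms(1) bounded_bilinear_scaleR])
      fix b :: 'e
      show "Ck_on k (\<lambda>x. frechet_derivative \<phi> (at x) v \<bullet> b) S"
        using Suc.prems(1)
        by (intro Ck_on_bounded_linear[OF assms(1) bounded_linear_inner_left]) simp
      show "Ck_on k (\<lambda>x. frechet_derivative h (at (\<phi> x)) b) S"
        using Suc.prems Ck_on_SucD[OF Suc.prems(1)] by (intro Suc.IH) auto
    qed
  qed
qed

lemma smooth_on_eq:
  "smooth_on S h \<Longrightarrow> open S \<Longrightarrow> (\<And>x. x \<in> S \<Longrightarrow> h x = h' x) \<Longrightarrow> smooth_on S h'"
  using Ck_on_cong[of S h h'] by (auto simp: smooth_on_def)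

lemma smooth_on_const: "smooth_on S (\<lambda>x. c)"
  by (simp add: smooth_on_def Ck_on_const)

lemma smooth_on_bounded_linear:
  "open S \<Longrightarrow> bounded_linear L \<Longrightarrow> smooth_on S h \<Longrightarrow> smooth_on S (\<lambda>x. L (h x))"
  by (simp add: smooth_on_def Ck_on_bounded_linear)

lemma smooth_on_id: "open S \<Longrightarrow> smooth_on S (\<lambda>x. x)"
  unfolding smooth_on_def
proof
  fix k assume "open S"
  then show "Ck_on k (\<lambda>x. x) S"
    by (cases k) (auto intro: Ck_on_const)
qed

lemma smooth_on_add:
  "open S \<Longrightarrow> smooth_on S h \<Longrightarrow> smooth_on S h' \<Longrightarrow> smooth_on S (\<lambda>x. h x + h' x)"
  by (simp add: smooth_on_def Ck_on_add)

lemma smooth_on_sum: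
  "open S \<Longrightarrow> (\<And>i. i \<in> I \<Longrightarrow> smooth_on S (h i)) \<Longrightarrow> smooth_on S (\<lambda>x. \<Sum>i\<in>I. h i x)"
  by (simp add: smooth_on_def Ck_on_sum)

lemma smooth_on_bilinear:
  "open S \<Longrightarrow> bounded_bilinear B \<Longrightarrow> smooth_on S h \<Longrightarrow> smooth_on S h'
    \<Longrightarrow> smooth_on S (\<lambda>x. B (h x) (h' x))"
  by (simp add: smooth_on_def Ck_on_bilinear)

lemma smooth_on_compose:
  fixes h :: "'e::euclidean_space \<Rightarrow> 'b::real_normed_vector"
    and \<phi> :: "'d::euclidean_space \<Rightarrow> 'e"
  assumes "open S" "open T" "smooth_on S \<phi>" "smooth_on T h" "\<phi> ` S \<subseteq> T"
  shows "smooth_on S (\<lambda>x. h (\<phi> x))"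
  using assms unfolding smooth_on_def by (blast intro: Ck_on_compose)

lemma smooth_on_has_derivative:
  "smooth_on S h \<Longrightarrow> x \<in> S \<Longrightarrow> (h has_derivative frechet_derivative h (at x)) (at x)"
  unfolding smooth_on_def frechet_derivative_works[symmetric] by (metis Ck_on.simps(2))

lemma smooth_on_frechet_derivative:
  "smooth_on S h \<Longrightarrow> smooth_on S (\<lambda>x. frechet_derivative h (at x) v)"
  unfolding smooth_on_def by (metis Ck_on.simps(2))

text \<open>
  The alternating sum of \<open>h\<close> over the corners of a small parallelogram is a mixed second derivative
  at some nearby point, by the mean value theorem applied once in each direction. Since the sum is
  symmetric in the two sides, this is the source of Schwarz's theorem.
\<close>

lemma mixed_difference_mean_value:
  fixes h :: "'e::euclidean_space \<Rightarrow> real"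
  assumes s: "s > 0"
    and dh: "\<And>x. x \<in> ball u r \<Longrightarrow> (h has_derivative h' x) (at x)"
    and dv: "\<And>x. x \<in> ball u r \<Longrightarrow> ((\<lambda>x. h' x v) has_derivative h'' x) (at x)"
    and sr: "s * (norm v + norm w) < r"
  shows "\<exists>x\<in>cball u (s * (norm v + norm w)).
    h (u + s *\<^sub>R v + s *\<^sub>R w) - h (u + s *\<^sub>R v) - h (u + s *\<^sub>R w) + h u = s * s * h'' x w"
proof -
  have inb: "u + a *\<^sub>R v + b *\<^sub>R w \<in> cball u (s * (norm v + norm w))"
    if "0 \<le> a" "a \<le> s" "0 \<le> b" "b \<le> s" for a b
  proof -
    have "norm (a *\<^sub>R v + b *\<^sub>R w) \<le> a * norm v + b * norm w"
      using norm_triangle_ineq[of "a *\<^sub>R v" "b *\<^sub>R w"] that by simp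
    also have "\<dots> \<le> s * norm v + s * norm w"
      using that by (intro add_mono mult_right_mono) auto
    finally show ?thesis
      by (simp add: dist_norm algebra_simps norm_minus_commute)
  qed
  have inb': "u + a *\<^sub>R v + b *\<^sub>R w \<in> ball u r"
    if "0 \<le> a" "a \<le> s" "0 \<le> b" "b \<le> s" for a b
    using inb[OF that] sr by auto
  define G where "G a = h (u + a *\<^sub>R v + s *\<^sub>R w) - h (u + a *\<^sub>R v + 0 *\<^sub>R w)" for a
  have dG: "(G has_real_derivative h' (u + a *\<^sub>R v + s *\<^sub>R w) v - h' (u + a *\<^sub>R v + 0 *\<^sub>R w) v) (at a)"
    if "0 \<le> a" "a \<le> s" for a
  proof -
    have *: "((\<lambda>a. h (u + a *\<^sub>R v + b *\<^sub>R w)) has_real_derivative h' (u + a *\<^sub>R v + b *\<^sub>R w) v) (at a)"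
      if "0 \<le> b" "b \<le> s" for b
    proof -
      have d: "(h has_derivative h' (u + a *\<^sub>R v + b *\<^sub>R w)) (at (u + a *\<^sub>R v + b *\<^sub>R w))"
        using dh inb' that \<open>0 \<le> a\<close> \<open>a \<le> s\<close> by blast
      have "((\<lambda>a. h (u + a *\<^sub>R v + b *\<^sub>R w)) has_derivative
          (\<lambda>t. h' (u + a *\<^sub>R v + b *\<^sub>R w) (t *\<^sub>R v))) (at a)"
        by (rule has_derivative_compose[where f = "\<lambda>a. u + a *\<^sub>R v + b *\<^sub>R w", OF _ d])
          (auto intro!: derivative_eq_intros)
      then show ?thesis
        using linear_cmul[OF has_derivative_linear[OF d]]
        by (simp add: has_field_derivative_def mult_commute_abs)
    qed
    show ?thesis unfolding G_def
      using *[of s] *[of 0] s by (intro DERIV_diff) auto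
  qed
  obtain a where a: "0 < a" "a < s"
    "G s - G 0 = (s - 0) * (h' (u + a *\<^sub>R v + s *\<^sub>R w) v - h' (u + a *\<^sub>R v + 0 *\<^sub>R w) v)"
    using MVT2[OF s dG] by auto
  have dH: "((\<lambda>b. h' (u + a *\<^sub>R v + b *\<^sub>R w) v) has_real_derivative h'' (u + a *\<^sub>R v + b *\<^sub>R w) w) (at b)"
    if "0 \<le> b" "b \<le> s" for b
  proof -
    have d: "((\<lambda>x. h' x v) has_derivative h'' (u + a *\<^sub>R v + b *\<^sub>R w)) (at (u + a *\<^sub>R v + b *\<^sub>R w))"
      using dv inb' that a by force
    have "((\<lambda>b. h' (u + a *\<^sub>R v + b *\<^sub>R w) v) has_derivative
        (\<lambda>t. h'' (u + a *\<^sub>R v + b *\<^sub>R w) (t *\<^sub>R w))) (at b)"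
      by (rule has_derivative_compose[where f = "\<lambda>b. u + a *\<^sub>R v + b *\<^sub>R w", OF _ d])
        (auto intro!: derivative_eq_intros)
    then show ?thesis
      using linear_cmul[OF has_derivative_linear[OF d]]
      by (simp add: has_field_derivative_def mult_commute_abs)
  qed
  obtain b where b: "0 < b" "b < s"
    "h' (u + a *\<^sub>R v + s *\<^sub>R w) v - h' (u + a *\<^sub>R v + 0 *\<^sub>R w) v
      = (s - 0) * h'' (u + a *\<^sub>R v + b *\<^sub>R w) w"
    using MVT2[OF s dH] by auto
  show ?thesis
    using a b by (intro bexI[of _ "u + a *\<^sub>R v + b *\<^sub>R w"] inb) (auto simp: G_def)
qed

text \<open>
  The two orders of differentiation are compared on parallelograms shrinking to \<open>u\<close>, where both
  intermediate points converge to \<open>u\<close> and the second derivatives are continuous.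
\<close>

lemma frechet_derivative_symmetric:
  fixes h :: "'e::euclidean_space \<Rightarrow> real"
  assumes "open S" "smooth_on S h" "u \<in> S"
  shows "frechet_derivative (\<lambda>x. frechet_derivative h (at x) v) (at u) w
       = frechet_derivative (\<lambda>x. frechet_derivative h (at x) w) (at u) v"
proof -
  define H where "H v w x = frechet_derivative (\<lambda>x. frechet_derivative h (at x) v) (at x) w" for v w x
  have cont: "isCont (H v w) u" for v w
  proof -
    have "smooth_on S (H v w)"
      unfolding H_def by (intro smooth_on_frechet_derivative assms)
    then have "continuous_on S (H v w)" by (metis Ck_on.simps(1) smooth_on_def)
    then show ?thesis using assms continuous_on_eq_continuous_at by blast
  qed
  obtain r where r: "r > 0" "ball u r \<subseteq> S" using assms openE by blast
  have dh: "(h has_derivative frechet_derivative h (at x)) (at x)" if "x \<in> ball u r" for x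
    using that r assms(2) by (blast intro: smooth_on_has_derivative)
  have dv: "((\<lambda>x. frechet_derivative h (at x) v) has_derivative
      frechet_derivative (\<lambda>x. frechet_derivative h (at x) v) (at x)) (at x)"
    if "x \<in> ball u r" for x v
    using that r assms(2) by (blast intro: smooth_on_has_derivative smooth_on_frechet_derivative)
  define N where "N = norm v + norm w"
  \<comment> \<open>Scaled so that the parallelogram stays in \<open>ball u r\<close>; the summand \<open>1\<close> covers \<open>N = 0\<close>.\<close>
  define s where "s n = r / (N + 1) / real (n + 2)" for n
  have N: "N \<ge> 0" by (simp add: N_def)
  have s0: "s n > 0" for n using r N by (simp add: s_def)
  have sN: "s n * N < r" for n
  proof -
    have "N < (N + 1) * real (n + 2)"
      using N by (intro less_le_trans[OF _ mult_left_mono[of 1 "real (n+2)" "N + 1"]]) auto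
    then have "r * N < r * ((N + 1) * real (n + 2))" using r by simp
    then show ?thesis using N unfolding s_def by (simp add: divide_less_eq)
  qed
  have slim: "(\<lambda>n. s n * N) \<longlonglongrightarrow> 0"
  proof -
    have "(\<lambda>n. (r * N / (N + 1)) / real (n + 2)) \<longlonglongrightarrow> 0"
      by (rule LIMSEQ_ignore_initial_segment[OF lim_const_over_n])
    then show ?thesis by (simp add: s_def mult.commute)
  qed
  have "\<exists>x\<in>cball u (s n * N). \<exists>y\<in>cball u (s n * N). H v w x = H w v y" for n
  proof -
    have "\<exists>x\<in>cball u (s n * N). h (u + s n *\<^sub>R v + s n *\<^sub>R w) - h (u + s n *\<^sub>R v)
        - h (u + s n *\<^sub>R w) + h u = s n * s n * H v w x"
      using mixed_difference_mean_value[where v=v and w=w, OF s0[of n] dh dv] sN[of n]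
      by (auto simp: H_def N_def)
    then obtain x where x: "x \<in> cball u (s n * N)" "h (u + s n *\<^sub>R v + s n *\<^sub>R w) - h (u + s n *\<^sub>R v)
        - h (u + s n *\<^sub>R w) + h u = s n * s n * H v w x" by blast
    have "\<exists>y\<in>cball u (s n * N). h (u + s n *\<^sub>R w + s n *\<^sub>R v) - h (u + s n *\<^sub>R w)
        - h (u + s n *\<^sub>R v) + h u = s n * s n * H w v y"
      using mixed_difference_mean_value[where v=w and w=v, OF s0[of n] dh dv] sN[of n]
      by (auto simp: H_def N_def add.commute)
    then obtain y where y: "y \<in> cball u (s n * N)" "h (u + s n *\<^sub>R w + s n *\<^sub>R v) - h (u + s n *\<^sub>R w)
        - h (u + s n *\<^sub>R v) + h u = s n * s n * H w v y" by blast
    have swap: "u + s n *\<^sub>R w + s n *\<^sub>R v = u + s n *\<^sub>R v + s n *\<^sub>R w" by simp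
    have "s n * s n * H v w x = s n * s n * H w v y"
      using x(2) y(2)[unfolded swap] by linarith
    then have "H v w x = H w v y" using s0[of n] by simp
    with x(1) y(1) show ?thesis by blast
  qed
  then obtain x y where xy: "\<And>n. x n \<in> cball u (s n * N)" "\<And>n. y n \<in> cball u (s n * N)"
    "\<And>n. H v w (x n) = H w v (y n)" by metis
  have lim: "z \<longlonglongrightarrow> u" if "\<And>n. z n \<in> cball u (s n * N)" for z
    using that by (intro metric_tendsto_imp_tendsto[OF slim])
      (auto simp: dist_commute N s0 intro!: always_eventually order_trans[OF _ abs_ge_self])
  have "(\<lambda>n. H v w (x n)) \<longlonglongrightarrow> H v w u"
    using isCont_tendsto_compose[OF cont lim[OF xy(1)]] .
  moreover have "(\<lambda>n. H w v (y n)) \<longlonglongrightarrow> H w v u"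
    using isCont_tendsto_compose[OF cont lim[OF xy(2)]] .
  ultimately show ?thesis
    using LIMSEQ_unique xy(3) unfolding H_def by auto
qed

lemma smooth_on_frechet_derivative_apply:
  fixes h :: "'a::euclidean_space \<Rightarrow> 'b::real_normed_vector"
  assumes "open S" "smooth_on S h" "smooth_on S Y"
  shows "smooth_on S (\<lambda>u. frechet_derivative h (at u) (Y u))"
proof -
  have sm: "smooth_on S (\<lambda>u. \<Sum>b\<in>Basis. (Y u \<bullet> b) *\<^sub>R frechet_derivative h (at u) b)"
    using assms by (intro smooth_on_sum smooth_on_bilinear[OF _ bounded_bilinear_scaleR]
        smooth_on_bounded_linear[OF _ bounded_linear_inner_left] smooth_on_frechet_derivative)
  have eq: "frechet_derivative h (at u) (Y u) = (\<Sum>b\<in>Basis. (Y u \<bullet> b) *\<^sub>R frechet_derivative h (at u) b)"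
    if "u \<in> S" for u
    using smooth_on_has_derivative[OF assms(2) that]
    by (intro frechet_derivative_Basis) (auto simp: differentiable_def)
  show ?thesis by (rule smooth_on_eq[OF sm assms(1) eq[symmetric]])
qed

text \<open>
  The product rule for the pairing of the derivative of \<open>H\<close> with a varying vector \<open>G\<close>: in coordinates,
  the derivative of a function along a vector field is such a pairing.
\<close>

lemma has_derivative_frechet_derivative_apply:
  fixes H :: "'e::euclidean_space \<Rightarrow> real"
  assumes S: "open S" "smooth_on S H" "smooth_on S G" "u \<in> S"
  shows "((\<lambda>y. frechet_derivative H (at y) (G y)) has_derivative
    (\<lambda>v. frechet_derivative (\<lambda>y. frechet_derivative H (at y) (G u)) (at u) v
       + frechet_derivative H (at u) (frechet_derivative G (at u) v))) (at u)"
proof -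
  have diff: "H differentiable (at y)" if "y \<in> S" for y
    using smooth_on_has_derivative[OF S(2) that] by (auto simp: differentiable_def)
  have d: "((\<lambda>y. frechet_derivative H (at y) b) has_derivative
      frechet_derivative (\<lambda>y. frechet_derivative H (at y) b) (at u)) (at u)" for b
    by (intro smooth_on_has_derivative[OF smooth_on_frechet_derivative[OF S(2)] S(4)])
  have dG: "((\<lambda>y. G y \<bullet> b) has_derivative (\<lambda>v. frechet_derivative G (at u) v \<bullet> b)) (at u)" for b
    by (rule has_derivative_inner_left[OF smooth_on_has_derivative[OF S(3,4)]])
  have expand: "((\<lambda>y. frechet_derivative H (at y) (Z y)) has_derivative L) (at u)"
    if "((\<lambda>y. \<Sum>b\<in>Basis. (Z y \<bullet> b) * frechet_derivative H (at y) b) has_derivative L) (at u)" for Z L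
    by (rule has_derivative_transform_within_open[OF that S(1) S(4)])
       (use frechet_derivative_Basis[OF diff] in simp)
  have sec: "((\<lambda>y. frechet_derivative H (at y) w) has_derivative
      (\<lambda>v. \<Sum>b\<in>Basis. (w \<bullet> b) * frechet_derivative (\<lambda>y. frechet_derivative H (at y) b) (at u) v)) (at u)" for w
    by (rule expand) (intro has_derivative_sum has_derivative_mult_right d)
  have second: "frechet_derivative (\<lambda>y. frechet_derivative H (at y) w) (at u)
      = (\<lambda>v. \<Sum>b\<in>Basis. (w \<bullet> b) * frechet_derivative (\<lambda>y. frechet_derivative H (at y) b) (at u) v)" for w
    by (rule frechet_derivative_at[OF sec, symmetric])
  have "((\<lambda>y. frechet_derivative H (at y) (G y)) has_derivative
    (\<lambda>v. \<Sum>b\<in>Basis. (G u \<bullet> b) * frechet_derivative (\<lambda>y. frechet_derivative H (at y) b) (at u) v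
        + (frechet_derivative G (at u) v \<bullet> b) * frechet_derivative H (at u) b)) (at u)"
    by (rule expand) (intro has_derivative_sum has_derivative_mult d dG)
  then show ?thesis
    unfolding second[of "G u"] sum.distrib
    by (subst frechet_derivative_Basis[OF diff[OF S(4)], of "frechet_derivative G (at u) _"]) simp
qed

section \<open>Bump functions\<close>

text \<open>
  The powers of \<open>1 / t\<close> are included because they appear when \<open>e\<^sup>-\<^sup>1\<^sup>/\<^sup>t\<close> is differentiated: the span
  of these functions is closed under differentiation, so smoothness of all of them is one induction.
\<close>

definition flat :: "nat \<Rightarrow> real \<Rightarrow> real" where
  "flat m t = (if t > 0 then exp (- (1 / t)) * (1 / t) ^ m else 0)"

lemma flat_Suc: "flat m t = t * flat (Suc m) t"
  by (simp add: flat_def)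

lemma flat_le_fact: "\<bar>flat m t\<bar> \<le> fact m"
proof (cases "t > 0")
  case True
  \<comment> \<open>A single term of the exponential series.\<close>
  have "(1 / t) ^ m / fact m \<le> exp (1 / t)"
    using sum_le_suminf[OF summable_exp, of "{m}" "1 / t"] True exp_converges[of "1 / t"]
    by (simp add: sums_iff field_simps)
  then have "(1 / t) ^ m * exp (- (1 / t)) \<le> fact m"
    using True by (simp add: exp_minus divide_simps split: if_splits) (simp add: mult_ac)
  then show ?thesis using True by (simp add: flat_def mult.commute)
next
  case False
  then show ?thesis by (simp add: flat_def)
qed

lemma flat_has_derivative:
  "(flat m has_real_derivative flat (m + 2) t - real m * flat (m + 1) t) (at t)"
proof -
  consider "t > 0" | "t < 0" | "t = 0" by linarith
  then show ?thesis
  proof cases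
    case 1
    have "((\<lambda>t. exp (- (1 / t)) * (1 / t) ^ m) has_real_derivative flat (m + 2) t - real m * flat (m + 1) t) (at t)"
    proof -
      have d: "((\<lambda>t. 1 / t) has_real_derivative - ((1 / t) * (1 / t))) (at t)"
        using 1 by (auto intro!: derivative_eq_intros)
      have "((\<lambda>t. (1 / t) ^ m) has_real_derivative - (real m * (1 / t) ^ (m + 1))) (at t)"
        using DERIV_power[OF d, of m] by (cases m) (simp_all add: mult_ac)
      moreover have "((\<lambda>t. exp (- (1 / t))) has_real_derivative exp (- (1 / t)) * ((1 / t) * (1 / t))) (at t)"
        using DERIV_fun_exp[OF DERIV_minus[OF d]] by simp
      ultimately have "((\<lambda>t. exp (- (1 / t)) * (1 / t) ^ m) has_real_derivative
          exp (- (1 / t)) * ((1 / t) * (1 / t)) * (1 / t) ^ m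
          + - (real m * (1 / t) ^ (m + 1)) * exp (- (1 / t))) (at t)"
        by (rule DERIV_mult[rotated])
      then show ?thesis
        using 1 by (simp add: flat_def algebra_simps)
    qed
    then show ?thesis
      by (rule has_field_derivative_transform_within_open[where S = "{0<..}"])
         (use 1 in \<open>auto simp: flat_def\<close>)
  next
    case 2
    have "((\<lambda>t. 0) has_real_derivative 0) (at t)" by simp
    then have "(flat m has_real_derivative 0) (at t)"
      by (rule has_field_derivative_transform_within_open[where S = "{..<0}"])
         (use 2 in \<open>auto simp: flat_def\<close>)
    with 2 show ?thesis by (simp add: flat_def)
  next
    case 3
    have "(\<lambda>h. (flat m (0 + h) - flat m 0) / h) \<midarrow>0\<rightarrow> 0"
    proof (rule Lim_null_comparison)
      \<comment> \<open>At \<open>0\<close> the difference quotient is bounded by a multiple of \<open>\<bar>h\<bar>\<close>, since \<open>flat m\<close> is \<open>h\<^sup>2\<close> times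
        the bounded function \<open>flat (m + 2)\<close>.\<close>
      have "\<bar>flat m h / h\<bar> \<le> fact (m + 2) * \<bar>h\<bar>" for h
      proof -
        have "flat m h = h * h * flat (m + 2) h"
          using flat_Suc[of m h] flat_Suc[of "Suc m" h] by simp
        then have "\<bar>flat m h / h\<bar> = \<bar>h\<bar> * \<bar>flat (m + 2) h\<bar>" by (simp add: abs_mult)
        then show ?thesis
          using mult_left_mono[OF flat_le_fact[of "m + 2" h] abs_ge_zero[of h]]
          by (simp add: mult.commute)
      qed
      then show "\<forall>\<^sub>F h in at 0. norm ((flat m (0 + h) - flat m 0) / h) \<le> fact (m + 2) * \<bar>h\<bar>"
        by (simp add: flat_def)
      show "(\<lambda>h. fact (m + 2) * \<bar>h\<bar>) \<midarrow>0\<rightarrow> (0::real)"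
        by (intro tendsto_eq_intros) auto
    qed
    then have "(flat m has_real_derivative 0) (at 0)"
      unfolding DERIV_def .
    with 3 show ?thesis by (simp add: flat_def)
  qed
qed

lemma smooth_on_flat: "smooth_on UNIV (flat m)"
proof -
  have "Ck_on k (flat m) UNIV" for k
  proof (induction k arbitrary: m)
    case 0
    show ?case
      by (auto intro!: continuous_at_imp_continuous_on DERIV_isCont[OF flat_has_derivative])
  next
    case (Suc k)
    show ?case
    proof (rule Ck_on_SucI[where h' = "\<lambda>t v. (flat (m + 2) t + - real m * flat (m + 1) t) * v"])
      show "(flat m has_derivative (\<lambda>v. (flat (m + 2) t + - real m * flat (m + 1) t) * v)) (at t)" for t
        using flat_has_derivative[of m t] by (simp add: has_field_derivative_def)
      show "Ck_on k (\<lambda>t. (flat (m + 2) t + - real m * flat (m + 1) t) * v) UNIV" for v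
        by (intro Ck_on_bilinear[OF _ bounded_bilinear_mult] Ck_on_add Ck_on_const Suc.IH open_UNIV)
    qed auto
  qed
  then show ?thesis by (simp add: smooth_on_def)
qed

text \<open>
  The function is \<open>flat 0\<close> of \<open>r\<^sup>2 - \<bar>u - u0\<bar>\<^sup>2\<close>, normalized at \<open>u0\<close>. It is not constant near \<open>u0\<close>, but its
  derivative vanishes there, and this first-order flatness is enough for all later cut-offs.
\<close>

lemma euclidean_bump:
  fixes u0 :: "'e::euclidean_space"
  assumes r: "r > 0"
  obtains \<psi> :: "'e \<Rightarrow> real" where "smooth_on UNIV \<psi>" "\<psi> u0 = 1"
    "(\<psi> has_derivative (\<lambda>v. 0)) (at u0)" "\<And>u. u \<notin> ball u0 r \<Longrightarrow> \<psi> u = 0"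
proof
  define \<psi> where "\<psi> u = flat 0 (r\<^sup>2 + (u - u0) \<bullet> (u0 - u)) * inverse (flat 0 (r\<^sup>2))" for u
  have sm: "smooth_on UNIV (\<lambda>u. r\<^sup>2 + (u - u0) \<bullet> (u0 - u))"
  proof (intro smooth_on_add smooth_on_const smooth_on_bilinear[OF _ bounded_bilinear_inner])
    have "smooth_on UNIV (\<lambda>u. u + - u0)" "smooth_on UNIV (\<lambda>u. u0 + - u)"
      by (intro smooth_on_add smooth_on_const smooth_on_id
          smooth_on_bounded_linear[OF _ bounded_linear_minus[OF bounded_linear_ident]] open_UNIV)+
    then show "smooth_on UNIV (\<lambda>u. u - u0)" "smooth_on UNIV (\<lambda>u. u0 - u)" by simp_all
  qed auto
  then show "smooth_on UNIV \<psi>" unfolding \<psi>_def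
    by (intro smooth_on_bilinear[OF _ bounded_bilinear_mult] smooth_on_const
        smooth_on_compose[OF _ _ sm smooth_on_flat]) auto
  show "\<psi> u0 = 1" using r by (simp add: \<psi>_def flat_def)
  show "(\<psi> has_derivative (\<lambda>v. 0)) (at u0)"
  proof -
    have q: "((\<lambda>u. r\<^sup>2 + (u - u0) \<bullet> (u0 - u)) has_derivative (\<lambda>v. 0)) (at u0)"
      by (auto intro!: derivative_eq_intros)
    have d: "(flat 0 has_derivative (*) (flat (0 + 2) (r\<^sup>2 + (u0 - u0) \<bullet> (u0 - u0))
        - real 0 * flat (0 + 1) (r\<^sup>2 + (u0 - u0) \<bullet> (u0 - u0)))) (at (r\<^sup>2 + (u0 - u0) \<bullet> (u0 - u0)))"
      using flat_has_derivative[unfolded has_field_derivative_def] .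
    have "((\<lambda>u. flat 0 (r\<^sup>2 + (u - u0) \<bullet> (u0 - u))) has_derivative (\<lambda>v. 0)) (at u0)"
      using has_derivative_compose[OF q d] by simp
    then show ?thesis unfolding \<psi>_def by (auto intro!: derivative_eq_intros)
  qed
  show "\<psi> u = 0" if "u \<notin> ball u0 r" for u
  proof -
    have "r\<^sup>2 \<le> (norm (u - u0))\<^sup>2"
      using that r by (intro power_mono) (auto simp: dist_norm norm_minus_commute)
    then have "r\<^sup>2 + (u - u0) \<bullet> (u0 - u) \<le> 0"
      by (simp add: power2_norm_eq_inner algebra_simps inner_commute)
    then show ?thesis by (simp add: \<psi>_def flat_def)
  qed
qed

section \<open>Change of coordinates\<close>

text \<open>
  With \<open>c = chart_at A q\<close> this map turns a tangent vector at \<open>q\<close> into its components in the chart \<open>d\<close>, and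
  with \<open>d = chart_at A q\<close> it turns components in \<open>c\<close> into a tangent vector.
\<close>

definition jac :: "('m, 'e::euclidean_space) chart \<Rightarrow> ('m, 'e) chart \<Rightarrow> 'm \<Rightarrow> 'e \<Rightarrow> 'e" where
  "jac c d q = frechet_derivative (snd d \<circ> chart_inv c) (at (snd c q))"

locale smooth_manifold =
  fixes A :: "('m::t2_space, 'e::euclidean_space) chart set"
  assumes atlas: "smooth_atlas A"
begin

lemma chart_props:
  assumes "c \<in> A"
  shows open_chart_domain: "open (fst c)" and open_chart_image: "open (chart_image c)"
    and homeomorphism_chart: "homeomorphism (fst c) (chart_image c) (snd c) (chart_inv c)"
  using atlas assms by (auto simp: smooth_atlas_def is_chart_def)

lemma chart_inv_chart [simp]: "c \<in> A \<Longrightarrow> q \<in> fst c \<Longrightarrow> chart_inv c (snd c q) = q"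
  using homeomorphism_chart homeomorphism_def by metis

lemma chart_chart_inv [simp]: "c \<in> A \<Longrightarrow> u \<in> chart_image c \<Longrightarrow> snd c (chart_inv c u) = u"
  using homeomorphism_chart homeomorphism_def by metis

lemma chart_inv_in [simp]: "c \<in> A \<Longrightarrow> u \<in> chart_image c \<Longrightarrow> chart_inv c u \<in> fst c"
  using homeomorphism_chart homeomorphism_def by blast

lemma chart_in_image [simp]: "q \<in> fst c \<Longrightarrow> snd c q \<in> chart_image c"
  by (simp add: chart_image_def)

lemma chart_at_mem [simp]: "chart_at A p \<in> A" and chart_at_dom [simp]: "p \<in> fst (chart_at A p)"
proof -
  have "p \<in> (\<Union>c\<in>A. fst c)" using atlas by (simp add: smooth_atlas_def)
  then have "\<exists>c. c \<in> A \<and> p \<in> fst c" by blast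
  from someI_ex[OF this] show "chart_at A p \<in> A" "p \<in> fst (chart_at A p)"
    by (auto simp: chart_at_def)
qed

lemma open_overlap:
  assumes "c \<in> A" "d \<in> A"
  shows "open (snd c ` (fst c \<inter> fst d))"
proof -
  have "openin (top_of_set (chart_image c)) (snd c ` (fst c \<inter> fst d))"
    using homeomorphism_imp_open_map[OF homeomorphism_chart[OF assms(1)]]
      open_chart_domain[OF assms(2)] by blast
  then show ?thesis using open_chart_image[OF assms(1)] openin_open_eq by blast
qed

lemma overlap_iff: "c \<in> A \<Longrightarrow> u \<in> snd c ` (fst c \<inter> fst d) \<longleftrightarrow> u \<in> chart_image c \<and> chart_inv c u \<in> fst d"
  by (auto simp: chart_image_def)

lemma transition_smooth:
  "c \<in> A \<Longrightarrow> d \<in> A \<Longrightarrow> smooth_on (snd c ` (fst c \<inter> fst d)) (snd d \<circ> chart_inv c)"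
  using atlas by (auto simp: smooth_atlas_def)

lemma jac_has_derivative:
  assumes "c \<in> A" "d \<in> A" "q \<in> fst c" "q \<in> fst d"
  shows "((snd d \<circ> chart_inv c) has_derivative jac c d q) (at (snd c q))"
  unfolding jac_def
  by (rule smooth_on_has_derivative[OF transition_smooth]) (use assms in auto)

lemma jac_linear:
  assumes "c \<in> A" "d \<in> A" "q \<in> fst c" "q \<in> fst d"
  shows "linear (jac c d q)"
  using has_derivative_linear[OF jac_has_derivative[OF assms]] .

text \<open>
  The chain rule in the form used for all objects on the manifold: \<open>h\<close> may be real-valued, or itself
  a coordinate map, in which case this is the cocycle rule for the Jacobians.
\<close>

lemma derivative_chart_change:
  assumes cd: "c \<in> A" "d \<in> A" "q \<in> fst c" "q \<in> fst d"
    and h: "((h \<circ> chart_inv d) has_derivative L) (at (snd d q))"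
  shows "((h \<circ> chart_inv c) has_derivative (\<lambda>v. L (jac c d q v))) (at (snd c q))"
proof -
  have "(snd d \<circ> chart_inv c) (snd c q) = snd d q" using cd by simp
  with h have "((h \<circ> chart_inv d) has_derivative L) (at ((snd d \<circ> chart_inv c) (snd c q)))"
    by simp
  from has_derivative_compose[OF jac_has_derivative[OF cd] this]
  have "((\<lambda>u. (h \<circ> chart_inv d) ((snd d \<circ> chart_inv c) u)) has_derivative
    (\<lambda>v. L (jac c d q v))) (at (snd c q))" .
  then show ?thesis
    by (rule has_derivative_transform_within_open[OF _ open_overlap[OF cd(1,2)]])
       (use cd in auto)
qed

lemma jac_compose:
  assumes "a \<in> A" "b \<in> A" "c \<in> A" "q \<in> fst a" "q \<in> fst b" "q \<in> fst c"
  shows "jac b c q (jac a b q v) = jac a c q v"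
proof -
  have "((snd c \<circ> chart_inv a) has_derivative (\<lambda>v. jac b c q (jac a b q v))) (at (snd a q))"
    using assms by (intro derivative_chart_change jac_has_derivative)
  from has_derivative_unique[OF this jac_has_derivative] show ?thesis
    using assms by metis
qed

lemma jac_same [simp]:
  assumes "c \<in> A" "q \<in> fst c"
  shows "jac c c q v = v"
proof -
  have "((\<lambda>u. u) has_derivative (\<lambda>v. v)) (at (snd c q))" by simp
  then have "((snd c \<circ> chart_inv c) has_derivative (\<lambda>v. v)) (at (snd c q))"
    by (rule has_derivative_transform_within_open[OF _ open_chart_image[OF assms(1)]])
       (use assms in auto)
  from has_derivative_unique[OF this jac_has_derivative] show ?thesis
    using assms by metis
qed

lemma differential_chart: "differential A (snd c) q = jac (chart_at A q) c q"
  by (simp add: differential_def jac_def fun_eq_iff)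

lemma in_chart_eq: "in_chart A c X u = jac (chart_at A (chart_inv c u)) c (chart_inv c u) (X (chart_inv c u))"
  by (simp add: in_chart_def differential_chart)

lemma in_chart_change:
  assumes "c \<in> A" "d \<in> A" "q \<in> fst c" "q \<in> fst d"
  shows "in_chart A d X (snd d q) = jac c d q (in_chart A c X (snd c q))"
  using assms by (simp add: in_chart_eq jac_compose)

lemma in_chart_chart_at: "in_chart A (chart_at A p) X (snd (chart_at A p) p) = X p"
  by (simp add: in_chart_eq)

section \<open>Smooth functions\<close>

text \<open>
  Transition maps are smooth, so one chart around each point decides smoothness in all charts.
\<close>

lemma smooth_function_local:
  assumes "\<And>q. \<exists>c\<in>A. q \<in> fst c \<and> (\<exists>U. open U \<and> snd c q \<in> U \<and> U \<subseteq> chart_image c \<and>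
    smooth_on U (h \<circ> chart_inv c))"
  shows "smooth_function A h"
  unfolding smooth_function_def
proof (intro ballI smooth_on_local)
  fix d u assume d: "d \<in> A" "u \<in> chart_image d"
  obtain c U where c: "c \<in> A" "chart_inv d u \<in> fst c" and U: "open U" "snd c (chart_inv d u) \<in> U"
    "U \<subseteq> chart_image c" "smooth_on U (h \<circ> chart_inv c)" using assms by blast
  define W where "W = snd d ` (fst d \<inter> fst c)"
  define T where "T = W \<inter> (snd c \<circ> chart_inv d) -` U"
  have W: "open W" "smooth_on W (snd c \<circ> chart_inv d)"
    using d c by (simp_all add: W_def open_overlap transition_smooth)
  then have "continuous_on W (snd c \<circ> chart_inv d)" by (metis Ck_on.simps(1) smooth_on_def)
  then have T: "open T" unfolding T_def using W U continuous_open_preimage by blast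
  have "smooth_on T (\<lambda>x. (h \<circ> chart_inv c) ((snd c \<circ> chart_inv d) x))"
    by (rule smooth_on_compose[OF T U(1) smooth_on_subset[OF W(2)] U(4)]) (unfold T_def, blast+)
  moreover have "(h \<circ> chart_inv c) ((snd c \<circ> chart_inv d) x) = (h \<circ> chart_inv d) x" if "x \<in> T" for x
    using that c d by (auto simp: T_def W_def)
  ultimately have "smooth_on T (h \<circ> chart_inv d)" using smooth_on_eq[OF _ T] by blast
  moreover have "u \<in> T" using d c U by (simp add: T_def W_def overlap_iff)
  ultimately show "\<exists>T. open T \<and> u \<in> T \<and> smooth_on T (h \<circ> chart_inv d)" using T by blast
qed

lemma smooth_function_const: "smooth_function A (\<lambda>q. k)"
  by (simp add: smooth_function_def comp_def smooth_on_const)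

lemma smooth_function_add:
  "smooth_function A h \<Longrightarrow> smooth_function A k \<Longrightarrow> smooth_function A (\<lambda>q. h q + k q)"
  unfolding smooth_function_def using open_chart_image by (auto simp: comp_def intro!: smooth_on_add)

lemma smooth_function_mult:
  "smooth_function A h \<Longrightarrow> smooth_function A k \<Longrightarrow> smooth_function A (\<lambda>q. h q * k q)"
  unfolding smooth_function_def using open_chart_image
  by (auto simp: comp_def intro!: smooth_on_bilinear[OF _ bounded_bilinear_mult])

lemma smooth_function_minus: "smooth_function A h \<Longrightarrow> smooth_function A (\<lambda>q. - h q)"
  using smooth_function_mult[OF smooth_function_const[of "-1"]] by auto

lemma smooth_function_diff:
  "smooth_function A h \<Longrightarrow> smooth_function A k \<Longrightarrow> smooth_function A (\<lambda>q. h q - k q)"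
  using smooth_function_add[OF _ smooth_function_minus, of h k] by auto

lemma smooth_function_sum:
  "(\<And>i. i \<in> I \<Longrightarrow> smooth_function A (h i)) \<Longrightarrow> smooth_function A (\<lambda>q. \<Sum>i\<in>I. h i q)"
  by (induction I rule: infinite_finite_induct)
     (auto intro: smooth_function_const smooth_function_add)

lemma smooth_function_has_derivative:
  assumes "smooth_function A h" "c \<in> A" "q \<in> fst c"
  shows "((h \<circ> chart_inv c) has_derivative (\<lambda>v. differential A h q (jac c (chart_at A q) q v))) (at (snd c q))"
proof (rule derivative_chart_change)
  show "((h \<circ> chart_inv (chart_at A q)) has_derivative differential A h q) (at (snd (chart_at A q) q))"
    unfolding differential_def
    using assms by (auto simp: smooth_function_def eta_contract_eq intro!: smooth_on_has_derivative)
qed (use assms in auto)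

lemma smooth_function_has_differential:
  assumes "smooth_function A h"
  shows "((h \<circ> chart_inv (chart_at A q)) has_derivative differential A h q) (at (snd (chart_at A q) q))"
  using smooth_function_has_derivative[OF assms chart_at_mem chart_at_dom, of q] by simp

lemma differentialI:
  assumes "((h \<circ> chart_inv (chart_at A q)) has_derivative L) (at (snd (chart_at A q) q))"
  shows "differential A h q = L"
  unfolding differential_def using frechet_derivative_at[OF assms] by simp

lemma differential_linear: "smooth_function A h \<Longrightarrow> linear (differential A h q)"
  using has_derivative_linear smooth_function_has_differential by blast

lemma differential_const: "differential A (\<lambda>q. k) q v = 0"
  by (simp add: differential_def comp_def)

lemma differential_add:
  assumes "smooth_function A h" "smooth_function A k"
  shows "differential A (\<lambda>q. h q + k q) q v = differential A h q v + differential A k q v"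
proof -
  have "(((\<lambda>q. h q + k q) \<circ> chart_inv (chart_at A q)) has_derivative
      (\<lambda>v. differential A h q v + differential A k q v)) (at (snd (chart_at A q) q))"
    using has_derivative_add[OF assms[THEN smooth_function_has_differential]] by (simp add: comp_def)
  from differentialI[OF this] show ?thesis by simp
qed

lemma differential_mult:
  assumes "smooth_function A h" "smooth_function A k"
  shows "differential A (\<lambda>q. h q * k q) q v = h q * differential A k q v + differential A h q v * k q"
proof -
  have "(((\<lambda>q. h q * k q) \<circ> chart_inv (chart_at A q)) has_derivative
      (\<lambda>v. h q * differential A k q v + differential A h q v * k q)) (at (snd (chart_at A q) q))"
    using has_derivative_mult[OF assms[THEN smooth_function_has_differential], of q] by (simp add: comp_def)
  from differentialI[OF this] show ?thesis by simp
qed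

lemma differential_eq_chart:
  assumes "smooth_function A h" "c \<in> A" "q \<in> fst c"
  shows "frechet_derivative (h \<circ> chart_inv c) (at (snd c q)) (jac (chart_at A q) c q v) = differential A h q v"
proof -
  have "frechet_derivative (h \<circ> chart_inv c) (at (snd c q)) = (\<lambda>v. differential A h q (jac c (chart_at A q) q v))"
    using frechet_derivative_at[OF smooth_function_has_derivative[OF assms]] by simp
  then show ?thesis using assms by (simp add: jac_compose)
qed

lemma deriv_along_in_chart:
  assumes "smooth_function A h" "c \<in> A" "u \<in> chart_image c"
  shows "(deriv_along A X h \<circ> chart_inv c) u = frechet_derivative (h \<circ> chart_inv c) (at u) (in_chart A c X u)"
  using differential_eq_chart[OF assms(1,2) chart_inv_in[OF assms(2,3)]] assms
  by (simp add: deriv_along_def in_chart_eq)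

lemma smooth_function_deriv_along:
  assumes "smooth_function A h" "vector_field A X"
  shows "smooth_function A (deriv_along A X h)"
  unfolding smooth_function_def
proof
  fix c assume c: "c \<in> A"
  have "smooth_on (chart_image c) (\<lambda>u. frechet_derivative (h \<circ> chart_inv c) (at u) (in_chart A c X u))"
    using assms c open_chart_image
    by (intro smooth_on_frechet_derivative_apply) (auto simp: smooth_function_def vector_field_def)
  then show "smooth_on (chart_image c) (deriv_along A X h \<circ> chart_inv c)"
    by (rule smooth_on_eq) (simp_all add: deriv_along_in_chart[OF assms(1) c] open_chart_image[OF c] del: comp_apply)
qed

section \<open>Vector fields\<close>

text \<open>
  The analogue for vector fields, whose components are in addition multiplied by the Jacobian of the
  transition map.
\<close>

lemma vector_field_local:
  assumes "\<And>q. \<exists>c\<in>A. q \<in> fst c \<and> (\<exists>U. open U \<and> snd c q \<in> U \<and> U \<subseteq> chart_image c \<and>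
    smooth_on U (in_chart A c X))"
  shows "vector_field A X"
  unfolding vector_field_def
proof (intro ballI smooth_on_local)
  fix d u assume d: "d \<in> A" "u \<in> chart_image d"
  obtain c U where c: "c \<in> A" "chart_inv d u \<in> fst c" and U: "open U" "snd c (chart_inv d u) \<in> U"
    "U \<subseteq> chart_image c" "smooth_on U (in_chart A c X)" using assms by blast
  define W W' where "W = snd d ` (fst d \<inter> fst c)" and "W' = snd c ` (fst c \<inter> fst d)"
  define T where "T = W \<inter> (snd c \<circ> chart_inv d) -` (U \<inter> W')"
  have W: "open W" "smooth_on W (snd c \<circ> chart_inv d)" "open W'" "smooth_on W' (snd d \<circ> chart_inv c)"
    using d c by (simp_all add: W_def W'_def open_overlap transition_smooth)
  then have "continuous_on W (snd c \<circ> chart_inv d)" by (metis Ck_on.simps(1) smooth_on_def)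
  then have T: "open T" unfolding T_def using W U continuous_open_preimage open_Int by metis
  have UO: "open (U \<inter> W')" using U W by blast
  have "smooth_on (U \<inter> W') (\<lambda>y. frechet_derivative (snd d \<circ> chart_inv c) (at y) (in_chart A c X y))"
    by (rule smooth_on_frechet_derivative_apply[OF UO smooth_on_subset[OF W(4)] smooth_on_subset[OF U(4)]])
       blast+
  from smooth_on_compose[OF T UO smooth_on_subset[OF W(2)] this] have "smooth_on T (\<lambda>x. frechet_derivative (snd d \<circ> chart_inv c) (at ((snd c \<circ> chart_inv d) x))
      (in_chart A c X ((snd c \<circ> chart_inv d) x)))"
    unfolding T_def by blast
  moreover have "frechet_derivative (snd d \<circ> chart_inv c) (at ((snd c \<circ> chart_inv d) x))
      (in_chart A c X ((snd c \<circ> chart_inv d) x)) = in_chart A d X x" if "x \<in> T" for x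
  proof -
    have x: "x \<in> chart_image d" "chart_inv d x \<in> fst c"
      using that d by (auto simp: T_def W_def overlap_iff)
    show ?thesis
      using in_chart_change[OF c(1) d(1) x(2) chart_inv_in[OF d(1) x(1)], of X] x d c
      by (simp add: jac_def)
  qed
  ultimately have "smooth_on T (in_chart A d X)" using smooth_on_eq[OF _ T] by blast
  moreover have "u \<in> T" using d c U by (auto simp: T_def W_def W'_def overlap_iff)
  ultimately show "\<exists>T. open T \<and> u \<in> T \<and> smooth_on T (in_chart A d X)" using T by blast
qed

lemma in_chart_linear:
  assumes "c \<in> A" "u \<in> chart_image c"
  shows "in_chart A c (\<lambda>q. X q + Y q) u = in_chart A c X u + in_chart A c Y u"
    and "in_chart A c (\<lambda>q. h q *\<^sub>R X q) u = h (chart_inv c u) *\<^sub>R in_chart A c X u"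
  using jac_linear[of "chart_at A (chart_inv c u)" c "chart_inv c u"] assms
  by (auto simp: in_chart_eq linear_add linear_cmul)

lemma vector_field_add:
  assumes "vector_field A X" "vector_field A Y"
  shows "vector_field A (\<lambda>q. X q + Y q)"
  unfolding vector_field_def
proof
  fix c assume c: "c \<in> A"
  have "smooth_on (chart_image c) (\<lambda>u. in_chart A c X u + in_chart A c Y u)"
    using assms c open_chart_image by (intro smooth_on_add) (auto simp: vector_field_def)
  then show "smooth_on (chart_image c) (in_chart A c (\<lambda>q. X q + Y q))"
    by (rule smooth_on_eq) (simp_all add: in_chart_linear(1)[OF c] open_chart_image[OF c])
qed

lemma vector_field_scale:
  assumes "smooth_function A h" "vector_field A X"
  shows "vector_field A (\<lambda>q. h q *\<^sub>R X q)"
  unfolding vector_field_def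
proof
  fix c assume c: "c \<in> A"
  have "smooth_on (chart_image c) (\<lambda>u. (h \<circ> chart_inv c) u *\<^sub>R in_chart A c X u)"
    using assms c open_chart_image
    by (intro smooth_on_bilinear[OF _ bounded_bilinear_scaleR]) (auto simp: vector_field_def smooth_function_def simp del: comp_apply)
  then show "smooth_on (chart_image c) (in_chart A c (\<lambda>q. h q *\<^sub>R X q))"
    by (rule smooth_on_eq) (simp_all add: in_chart_linear(2)[OF c] open_chart_image[OF c])
qed

lemma vector_field_zero: "vector_field A (\<lambda>q. 0)"
proof -
  have "in_chart A c (\<lambda>q. 0) u = 0" if "c \<in> A" "u \<in> chart_image c" for c u
    using in_chart_linear(2)[OF that, of "\<lambda>q. 0" "\<lambda>q. 0"] by simp
  then show ?thesis unfolding vector_field_def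
    by (intro ballI smooth_on_eq[OF smooth_on_const[of _ 0]]) (simp_all add: open_chart_image)
qed

lemma vector_field_cmul: "vector_field A X \<Longrightarrow> vector_field A (\<lambda>q. k *\<^sub>R X q)"
  by (rule vector_field_scale[OF smooth_function_const])

lemma vector_field_minus: "vector_field A X \<Longrightarrow> vector_field A (\<lambda>q. - X q)"
  using vector_field_cmul[of X "-1"] by simp

lemma vector_field_diff:
  "vector_field A X \<Longrightarrow> vector_field A Y \<Longrightarrow> vector_field A (\<lambda>q. X q - Y q)"
  using vector_field_add[OF _ vector_field_minus, of X Y] by simp

lemma vector_field_sum:
  "(\<And>i. i \<in> I \<Longrightarrow> vector_field A (X i)) \<Longrightarrow> vector_field A (\<lambda>q. \<Sum>i\<in>I. X i q)"
  by (induction I rule: infinite_finite_induct)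
     (auto intro: vector_field_zero vector_field_add)

section \<open>Cutting off and local frames\<close>

lemma open_chart_diff:
  assumes "d \<in> A" "closed K"
  shows "open (snd d ` (fst d - K))"
proof -
  have "openin (top_of_set (fst d)) (fst d - K)"
    using assms open_chart_domain[OF assms(1)] by (auto simp: openin_open_eq)
  then have "openin (top_of_set (chart_image d)) (snd d ` (fst d - K))"
    using homeomorphism_imp_open_map[OF homeomorphism_chart[OF assms(1)]] by blast
  then show ?thesis using open_chart_image[OF assms(1)] openin_open_eq by blast
qed

text \<open>
  Charts around points outside \<open>fst c\<close> see the zero function after removal of the closed set \<open>K\<close>.
\<close>

lemma smooth_function_extend_by_zero:
  assumes c: "c \<in> A" "closed K" "K \<subseteq> fst c" "\<And>q. q \<notin> K \<Longrightarrow> h q = 0"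
    and sm: "smooth_on (chart_image c) (h \<circ> chart_inv c)"
  shows "smooth_function A h"
proof (rule smooth_function_local)
  fix q
  show "\<exists>c\<in>A. q \<in> fst c \<and> (\<exists>U. open U \<and> snd c q \<in> U \<and> U \<subseteq> chart_image c \<and> smooth_on U (h \<circ> chart_inv c))"
  proof (cases "q \<in> fst c")
    case True
    then show ?thesis using c(1) sm open_chart_image[OF c(1)]
      by (intro bexI[of _ c] conjI exI[of _ "chart_image c"]) auto
  next
    case False
    define d where "d = chart_at A q"
    have d: "d \<in> A" "q \<in> fst d" by (simp_all add: d_def)
    have "smooth_on (snd d ` (fst d - K)) (h \<circ> chart_inv d)"
      by (rule smooth_on_eq[OF smooth_on_const[of _ 0] open_chart_diff[OF d(1) c(2)]])
         (use c d in auto)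
    moreover have "snd d ` (fst d - K) \<subseteq> chart_image d" by (auto simp: chart_image_def)
    moreover have "snd d q \<in> snd d ` (fst d - K)" using False c d by blast
    ultimately show ?thesis using d open_chart_diff[OF d(1) c(2)]
      by (intro bexI[of _ d] conjI exI[of _ "snd d ` (fst d - K)"])
  qed
qed

lemma vector_field_extend_by_zero:
  assumes c: "c \<in> A" "closed K" "K \<subseteq> fst c" "\<And>q. q \<notin> K \<Longrightarrow> X q = 0"
    and sm: "smooth_on (chart_image c) (in_chart A c X)"
  shows "vector_field A X"
proof (rule vector_field_local)
  fix q
  show "\<exists>c\<in>A. q \<in> fst c \<and> (\<exists>U. open U \<and> snd c q \<in> U \<and> U \<subseteq> chart_image c \<and> smooth_on U (in_chart A c X))"
  proof (cases "q \<in> fst c")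
    case True
    then show ?thesis using c(1) sm open_chart_image[OF c(1)]
      by (intro bexI[of _ c] conjI exI[of _ "chart_image c"]) auto
  next
    case False
    define d where "d = chart_at A q"
    have d: "d \<in> A" "q \<in> fst d" by (simp_all add: d_def)
    have "0 = in_chart A d X u" if "u \<in> snd d ` (fst d - K)" for u
      using that c d linear_0[OF jac_linear[OF chart_at_mem d(1) chart_at_dom]]
      by (auto simp: in_chart_eq)
    then have "smooth_on (snd d ` (fst d - K)) (in_chart A d X)"
      by (rule smooth_on_eq[OF smooth_on_const[of _ 0] open_chart_diff[OF d(1) c(2)]])
    moreover have "snd d ` (fst d - K) \<subseteq> chart_image d" by (auto simp: chart_image_def)
    moreover have "snd d q \<in> snd d ` (fst d - K)" using False c d by blast
    ultimately show ?thesis using d open_chart_diff[OF d(1) c(2)]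
      by (intro bexI[of _ d] conjI exI[of _ "snd d ` (fst d - K)"])
  qed
qed

text \<open>
  \<open>K\<close> is the image of a closed ball under the inverse chart; it is compact, hence closed because the
  manifold is Hausdorff.
\<close>

lemma bump_function:
  obtains \<phi> K where "smooth_function A \<phi>" "\<phi> p = 1" "\<And>v. differential A \<phi> p v = 0"
    "closed K" "K \<subseteq> fst (chart_at A p)" "\<And>q. q \<notin> K \<Longrightarrow> \<phi> q = 0"
proof -
  define c where "c = chart_at A p"
  have c: "c \<in> A" "p \<in> fst c" by (simp_all add: c_def)
  obtain r where r: "r > 0" "cball (snd c p) r \<subseteq> chart_image c"
    using open_chart_image[OF c(1)] chart_in_image[OF c(2)] open_contains_cball by blast
  obtain \<psi> where psi: "smooth_on UNIV \<psi>" "\<psi> (snd c p) = 1"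
    "(\<psi> has_derivative (\<lambda>v. 0)) (at (snd c p))" "\<And>u. u \<notin> ball (snd c p) r \<Longrightarrow> \<psi> u = (0::real)"
    using euclidean_bump[OF r(1)] by blast
  define K where "K = chart_inv c ` cball (snd c p) r"
  define \<phi> where "\<phi> q = (if q \<in> fst c then \<psi> (snd c q) else 0)" for q
  have "continuous_on (cball (snd c p) r) (chart_inv c)"
    using homeomorphism_cont2[OF homeomorphism_chart[OF c(1)]] r(2) continuous_on_subset by blast
  then have K: "closed K" unfolding K_def
    by (intro compact_imp_closed compact_continuous_image) auto
  have Kc: "K \<subseteq> fst c" unfolding K_def using r(2) c chart_inv_in by blast
  have 0: "\<phi> q = 0" if "q \<notin> K" for q
  proof (cases "q \<in> fst c")
    case True
    then have "snd c q \<notin> ball (snd c p) r"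
      using that c unfolding K_def by (metis ball_subset_cball chart_inv_chart image_eqI subsetD)
    then show ?thesis using psi(4) by (simp add: \<phi>_def)
  qed (simp add: \<phi>_def)
  have eq: "\<psi> u = (\<phi> \<circ> chart_inv c) u" if "u \<in> chart_image c" for u
    using that c by (simp add: \<phi>_def)
  have "smooth_on (chart_image c) (\<phi> \<circ> chart_inv c)"
    by (rule smooth_on_eq[OF smooth_on_subset[OF psi(1)] open_chart_image[OF c(1)] eq]) auto
  then have sm: "smooth_function A \<phi>"
    by (intro smooth_function_extend_by_zero[OF c(1) K Kc] 0)
  have "((\<phi> \<circ> chart_inv c) has_derivative (\<lambda>v. 0)) (at (snd c p))"
    by (rule has_derivative_transform_within_open[OF psi(3) open_chart_image[OF c(1)] _ eq]) (use c in auto)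
  then have d: "differential A \<phi> p v = 0" for v
    using differentialI[of \<phi> p] by (simp add: c_def)
  show ?thesis
    by (rule that[OF sm _ d K _ 0]) (use psi(2) c Kc in \<open>simp_all add: \<phi>_def c_def\<close>)
qed

text \<open>
  A frame around \<open>p\<close> made of global fields: \<open>E\<close> is the coordinate frame of the chart at \<open>p\<close> and \<open>\<Omega>\<close> its
  dual coframe, both multiplied by a bump function \<open>\<phi>\<close>. The expansion of a vector in the frame then
  holds at every point of the manifold up to the factor \<open>\<phi>\<^sup>2\<close>, which is \<open>1\<close> to first order at \<open>p\<close>.
\<close>

definition frame_at :: "'m \<Rightarrow> ('m \<Rightarrow> real) \<Rightarrow> ('e \<Rightarrow> 'm \<Rightarrow> 'e) \<Rightarrow> ('e \<Rightarrow> 'm \<Rightarrow> 'e \<Rightarrow> real) \<Rightarrow> bool" where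
  "frame_at p \<phi> E \<Omega> \<longleftrightarrow>
     smooth_function A \<phi> \<and> \<phi> p = 1 \<and> (\<forall>v. differential A \<phi> p v = 0) \<and>
     (\<forall>b. vector_field A (E b)) \<and> (\<forall>b. E b p = b) \<and> (\<forall>b q. linear (\<Omega> b q)) \<and>
     (\<forall>b X. vector_field A X \<longrightarrow> smooth_function A (\<lambda>q. \<Omega> b q (X q))) \<and>
     (\<forall>q v. (\<phi> q * \<phi> q) *\<^sub>R v = (\<Sum>b\<in>Basis. \<Omega> b q v *\<^sub>R E b q))"

lemma frame_atD:
  assumes "frame_at p \<phi> E \<Omega>"
  shows "smooth_function A \<phi>" "\<phi> p = 1" "differential A \<phi> p v = 0"
    "vector_field A (E b)" "E b p = b"
    "linear (\<Omega> b q)" "vector_field A X \<Longrightarrow> smooth_function A (\<lambda>q. \<Omega> b q (X q))"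
    "(\<phi> q * \<phi> q) *\<^sub>R v = (\<Sum>b\<in>Basis. \<Omega> b q v *\<^sub>R E b q)"
  using assms by (auto simp: frame_at_def)

lemma local_frame: "\<exists>\<phi> E \<Omega>. frame_at p \<phi> E \<Omega>"
proof -
  define c where "c = chart_at A p"
  have c: "c \<in> A" "p \<in> fst c" by (simp_all add: c_def)
  obtain \<phi> K where phi: "smooth_function A \<phi>" "\<phi> p = 1" "\<And>v. differential A \<phi> p v = 0"
    and K: "closed K" "K \<subseteq> fst c" "\<And>q. q \<notin> K \<Longrightarrow> \<phi> q = 0"
    using bump_function unfolding c_def by metis
  have smphi: "smooth_on (chart_image c) (\<phi> \<circ> chart_inv c)"
    using phi(1) c by (simp add: smooth_function_def)
  define E where "E b q = \<phi> q *\<^sub>R jac c (chart_at A q) q b" for b q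
  define \<Omega> where "\<Omega> b q v = \<phi> q * (jac (chart_at A q) c q v \<bullet> b)" for b q v
  have E: "vector_field A (E b)" for b
  proof (rule vector_field_extend_by_zero[OF c(1) K(1,2)])
    show "E b q = 0" if "q \<notin> K" for q using K(3)[OF that] by (simp add: E_def)
    have eq: "(\<phi> \<circ> chart_inv c) u *\<^sub>R b = in_chart A c (E b) u" if "u \<in> chart_image c" for u
    proof -
      have *: "chart_inv c u \<in> fst c" using that c by simp
      show ?thesis
        using * c jac_linear[of "chart_at A (chart_inv c u)" c "chart_inv c u"]
        by (simp add: in_chart_eq E_def linear_cmul jac_compose)
    qed
    show "smooth_on (chart_image c) (in_chart A c (E b))"
      by (rule smooth_on_eq[OF _ open_chart_image[OF c(1)] eq])
         (intro smooth_on_bilinear[OF _ bounded_bilinear_scaleR] smphi smooth_on_const open_chart_image c)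
  qed
  have Ep: "E b p = b" for b using phi(2) c by (simp add: E_def c_def)
  have lin: "linear (\<Omega> b q)" for b q
  proof (cases "q \<in> fst c")
    case True
    then show ?thesis
      using jac_linear[of "chart_at A q" c q] c
      by (intro linearI) (auto simp: \<Omega>_def linear_add linear_cmul algebra_simps)
  next
    case False
    then have "\<phi> q = 0" using K by blast
    then show ?thesis by (intro linearI) (auto simp: \<Omega>_def)
  qed
  have sm: "smooth_function A (\<lambda>q. \<Omega> b q (X q))" if X: "vector_field A X" for b X
  proof (rule smooth_function_extend_by_zero[OF c(1) K(1,2)])
    show "\<Omega> b q (X q) = 0" if "q \<notin> K" for q using K(3)[OF that] by (simp add: \<Omega>_def)
    have "smooth_on (chart_image c) (\<lambda>u. (\<phi> \<circ> chart_inv c) u * (in_chart A c X u \<bullet> b))"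
      using X c by (intro smooth_on_bilinear[OF _ bounded_bilinear_mult] smphi open_chart_image
          smooth_on_bounded_linear[OF _ bounded_linear_inner_left]) (auto simp: vector_field_def)
    then show "smooth_on (chart_image c) ((\<lambda>q. \<Omega> b q (X q)) \<circ> chart_inv c)"
      by (simp add: comp_def \<Omega>_def in_chart_eq)
  qed
  have rep: "(\<phi> q * \<phi> q) *\<^sub>R v = (\<Sum>b\<in>Basis. \<Omega> b q v *\<^sub>R E b q)" for q v
  proof (cases "q \<in> fst c")
    case True
    interpret linear "jac c (chart_at A q) q" using True c by (simp add: jac_linear)
    have "v = jac c (chart_at A q) q (jac (chart_at A q) c q v)"
      using True c by (simp add: jac_compose)
    also have "\<dots> = jac c (chart_at A q) q (\<Sum>b\<in>Basis. (jac (chart_at A q) c q v \<bullet> b) *\<^sub>R b)"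
      by (simp add: euclidean_representation)
    also have "\<dots> = (\<Sum>b\<in>Basis. (jac (chart_at A q) c q v \<bullet> b) *\<^sub>R jac c (chart_at A q) q b)"
      by (simp add: sum scale)
    finally have "(\<phi> q * \<phi> q) *\<^sub>R v = (\<phi> q * \<phi> q) *\<^sub>R (\<Sum>b\<in>Basis. (jac (chart_at A q) c q v \<bullet> b) *\<^sub>R jac c (chart_at A q) q b)"
      by simp
    then show ?thesis by (simp add: scaleR_sum_right \<Omega>_def E_def mult_ac)
  next
    case False
    then have "\<phi> q = 0" using K by blast
    then show ?thesis by (simp add: \<Omega>_def)
  qed
  have "frame_at p \<phi> E \<Omega>"
    unfolding frame_at_def using phi E Ep lin sm rep by blast
  then show ?thesis by blast
qed

lemma vector_field_through: "\<exists>X. vector_field A X \<and> X p = v"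
  using local_frame[of p] frame_atD(4,5) by metis

lemma extension: "vector_field A (extension A p v)" "extension A p v p = v"
  using someI_ex[OF vector_field_through[of p v]] by (auto simp: extension_def)

text \<open>
  The coordinate functions of the chart at \<open>p\<close>, cut off by a bump function, are global smooth functions
  whose differentials at \<open>p\<close> are the components of the vector. Hence identities between vector fields can
  be proved for the derivations that they define.
\<close>

lemma differential_separates:
  assumes "\<And>h. smooth_function A h \<Longrightarrow> differential A h p v = differential A h p w"
  shows "v = w"
proof (rule euclidean_eqI)
  fix b :: 'e
  define c where "c = chart_at A p"
  have c: "c \<in> A" "p \<in> fst c" by (simp_all add: c_def)
  obtain \<phi> K where phi: "smooth_function A \<phi>" "\<phi> p = 1" "\<And>v. differential A \<phi> p v = 0"
    and K: "closed K" "K \<subseteq> fst c" "\<And>q. q \<notin> K \<Longrightarrow> \<phi> q = 0"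
    using bump_function unfolding c_def by metis
  define h where "h q = \<phi> q * (snd c q \<bullet> b)" for q
  have eq: "(\<phi> \<circ> chart_inv c) u * (u \<bullet> b) = (h \<circ> chart_inv c) u" if "u \<in> chart_image c" for u
    using that c by (simp add: h_def)
  have "smooth_on (chart_image c) (\<lambda>u. (\<phi> \<circ> chart_inv c) u * (u \<bullet> b))"
    using phi(1) c by (intro smooth_on_bilinear[OF _ bounded_bilinear_mult] open_chart_image
      smooth_on_bounded_linear[OF _ bounded_linear_inner_left] smooth_on_id) (auto simp: smooth_function_def simp del: comp_apply)
  then have "smooth_on (chart_image c) (h \<circ> chart_inv c)"
    by (rule smooth_on_eq[OF _ open_chart_image[OF c(1)] eq])
  then have sm: "smooth_function A h"
    by (intro smooth_function_extend_by_zero[OF c(1) K(1,2)]) (simp_all add: h_def K)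
  have "((\<phi> \<circ> chart_inv c) has_derivative (\<lambda>v. 0)) (at (snd c p))"
    using smooth_function_has_differential[OF phi(1), of p] phi(3)
    by (simp add: c_def ext[of "differential A \<phi> p" "\<lambda>v. 0"])
  from has_derivative_mult[OF this has_derivative_inner_left[OF has_derivative_ident]]
  have "((\<lambda>u. (\<phi> \<circ> chart_inv c) u * (u \<bullet> b)) has_derivative (\<lambda>v. v \<bullet> b)) (at (snd c p))"
    using c phi(2) by simp
  then have "((h \<circ> chart_inv c) has_derivative (\<lambda>v. v \<bullet> b)) (at (snd c p))"
    by (rule has_derivative_transform_within_open[OF _ open_chart_image[OF c(1)] _ eq]) (use c in auto)
  then have "differential A h p = (\<lambda>v. v \<bullet> b)" using differentialI by (simp add: c_def)
  then show "v \<bullet> b = w \<bullet> b" using assms[OF sm] by simp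
qed

text \<open>
  In coordinates the second derivatives of \<open>h\<close> cancel by symmetry, and the remaining terms are the
  derivative of \<open>h\<close> along \<open>DY X - DX Y\<close>.
\<close>

lemma deriv_along_lie_bracket:
  assumes h: "smooth_function A h" and X: "vector_field A X" and Y: "vector_field A Y"
  shows "deriv_along A (lie_bracket A X Y) h p =
    deriv_along A X (deriv_along A Y h) p - deriv_along A Y (deriv_along A X h) p"
proof -
  define c where "c = chart_at A p"
  define u where "u = snd c p"
  define H where "H = h \<circ> chart_inv c"
  let ?S = "chart_image c"
  have c: "c \<in> A" "p \<in> fst c" by (simp_all add: c_def)
  have S: "open ?S" "u \<in> ?S" using c open_chart_image by (simp_all add: u_def)
  have H: "smooth_on ?S H" using h c by (simp add: H_def smooth_function_def)
  have Z: "smooth_on ?S (in_chart A c Z)" if "vector_field A Z" for Z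
    using that c by (simp add: vector_field_def)
  have at: "in_chart A c Z u = Z p" for Z
    unfolding c_def u_def by (rule in_chart_chart_at)
  have first: "deriv_along A Z h p = frechet_derivative H (at u) (Z p)" for Z
    by (simp add: deriv_along_def differential_def H_def c_def u_def)
  have second: "deriv_along A W (deriv_along A Z h) p =
      frechet_derivative (\<lambda>y. frechet_derivative H (at y) (Z p)) (at u) (W p)
      + frechet_derivative H (at u) (frechet_derivative (in_chart A c Z) (at u) (W p))"
    if "vector_field A Z" for Z W
  proof -
    have "((\<lambda>y. frechet_derivative H (at y) (in_chart A c Z y)) has_derivative
      (\<lambda>v. frechet_derivative (\<lambda>y. frechet_derivative H (at y) (Z p)) (at u) v
       + frechet_derivative H (at u) (frechet_derivative (in_chart A c Z) (at u) v))) (at u)"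
      using has_derivative_frechet_derivative_apply[OF S(1) H Z[OF that] S(2)] by (simp add: at)
    then have "((deriv_along A Z h \<circ> chart_inv c) has_derivative
      (\<lambda>v. frechet_derivative (\<lambda>y. frechet_derivative H (at y) (Z p)) (at u) v
       + frechet_derivative H (at u) (frechet_derivative (in_chart A c Z) (at u) v))) (at u)"
      by (rule has_derivative_transform_within_open[OF _ S])
         (use deriv_along_in_chart[OF h c(1)] in \<open>simp add: H_def\<close>)
    then show ?thesis
      using differentialI[of "deriv_along A Z h" p] by (simp add: deriv_along_def[of A W] c_def u_def)
  qed
  have lin: "linear (frechet_derivative H (at u))"
    using smooth_on_has_derivative[OF H S(2)] by (rule has_derivative_linear)
  have "lie_bracket A X Y p = frechet_derivative (in_chart A c Y) (at u) (X p)
      - frechet_derivative (in_chart A c X) (at u) (Y p)"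
    by (simp add: lie_bracket_def Let_def c_def u_def)
  then show ?thesis
    using frechet_derivative_symmetric[OF S(1) H S(2), of "X p" "Y p"]
    by (simp add: first second X Y linear_diff[OF lin])
qed

lemma constant_if_differential_zero:
  assumes "connected (UNIV :: 'm set)" "smooth_function A h" "\<And>p v. differential A h p v = 0"
  shows "\<exists>k. \<forall>p. h p = k"
proof -
  have "h constant_on (UNIV :: 'm set)"
  proof (rule locally_constant_imp_constant[OF assms(1)])
    fix p :: 'm
    define c where "c = chart_at A p"
    have c: "c \<in> A" "p \<in> fst c" by (simp_all add: c_def)
    obtain r where r: "r > 0" "ball (snd c p) r \<subseteq> chart_image c"
      using open_chart_image[OF c(1)] chart_in_image[OF c(2)] openE by blast
    have "((h \<circ> chart_inv c) has_derivative (\<lambda>v. 0)) (at u within ball (snd c p) r)"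
      if "u \<in> ball (snd c p) r" for u
      using smooth_function_has_derivative[OF assms(2) c(1), of "chart_inv c u"] that r c assms(3)
      by (auto intro!: has_derivative_at_withinI simp: subset_iff)
    then obtain k where k: "\<And>u. u \<in> ball (snd c p) r \<Longrightarrow> (h \<circ> chart_inv c) u = k"
      using has_derivative_zero_constant[OF convex_ball] by metis
    have "open (fst c \<inter> snd c -` ball (snd c p) r)"
      using homeomorphism_cont1[OF homeomorphism_chart[OF c(1)]] open_chart_domain[OF c(1)]
      by (intro continuous_open_preimage) auto
    moreover have "h q = k" if "q \<in> fst c \<inter> snd c -` ball (snd c p) r" for q
      using k[of "snd c q"] that c by auto
    moreover have "p \<in> fst c \<inter> snd c -` ball (snd c p) r" using c r by simp
    ultimately show "\<exists>T. openin (top_of_set UNIV) T \<and> p \<in> T \<and> (\<forall>x\<in>T. h x = h p)"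
      by (intro exI[of _ "fst c \<inter> snd c -` ball (snd c p) r"]) auto
  qed
  then show ?thesis by (auto simp: constant_on_def)
qed

end

section \<open>Traces of endomorphisms\<close>

lemma trace_endo_add: "trace_endo (\<lambda>w. S w + T w) = trace_endo S + trace_endo T"
  by (simp add: trace_endo_def inner_add_left sum.distrib)

lemma trace_endo_diff: "trace_endo (\<lambda>w. S w - T w) = trace_endo S - trace_endo T"
  by (simp add: trace_endo_def inner_diff_left sum_subtractf)

lemma trace_endo_scale: "trace_endo (\<lambda>w. k *\<^sub>R S w) = k * trace_endo S"
  by (simp add: trace_endo_def sum_distrib_left)

lemma trace_endo_minus: "trace_endo (\<lambda>w. - S w) = - trace_endo S"
  by (simp add: trace_endo_def sum_negf)

lemma trace_endo_id: "trace_endo (\<lambda>w::'e::euclidean_space. w) = real DIM('e)"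
  by (simp add: trace_endo_def)

lemma linear_Basis_expand:
  assumes "linear T"
  shows "T v = (\<Sum>a\<in>Basis. (v \<bullet> a) *\<^sub>R T a)"
proof -
  interpret linear T by fact
  have "T v = T (\<Sum>a\<in>Basis. (v \<bullet> a) *\<^sub>R a)" by (simp add: euclidean_representation)
  then show ?thesis by (simp add: sum scale)
qed

lemma trace_endo_rank_one:
  assumes "linear \<alpha>"
  shows "trace_endo (\<lambda>w. \<alpha> w *\<^sub>R v) = \<alpha> v"
  by (subst linear_Basis_expand[OF assms, of v]) (simp add: trace_endo_def mult.commute)

text \<open>
  The trace may be computed in any frame and coframe that expand vectors; \<open>k\<close> absorbs the factor
  \<open>\<phi>\<^sup>2\<close> of a cut-off frame.
\<close>

lemma trace_endo_frame:
  assumes "linear T" "\<And>b. linear (\<Omega> b)"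
    and "\<And>v. k *\<^sub>R v = (\<Sum>b\<in>Basis. \<Omega> b v *\<^sub>R E b)"
  shows "(\<Sum>b\<in>Basis. \<Omega> b (T (E b))) = k * trace_endo T"
proof -
  have "(\<Sum>b\<in>Basis. \<Omega> b (T (E b))) = (\<Sum>b\<in>Basis. \<Sum>a\<in>Basis. (E b \<bullet> a) * \<Omega> b (T a))"
    by (intro sum.cong refl, subst linear_Basis_expand[OF linear_compose[OF assms(1,2)], unfolded comp_def]) simp
  also have "\<dots> = (\<Sum>a\<in>Basis. (\<Sum>b\<in>Basis. \<Omega> b (T a) *\<^sub>R E b) \<bullet> a)"
    by (subst sum.swap) (simp add: inner_sum_left mult.commute)
  also have "\<dots> = k * trace_endo T"
    by (simp add: assms(3)[symmetric] trace_endo_def sum_distrib_left)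
  finally show ?thesis .
qed

lemma trace_endo_commute:
  fixes S T :: "'e::euclidean_space \<Rightarrow> 'e"
  assumes "linear S" "linear T"
  shows "trace_endo (\<lambda>w. S (T w)) = trace_endo (\<lambda>w. T (S w))"
proof -
  have expand: "trace_endo (\<lambda>w. S (T w)) = (\<Sum>b\<in>Basis. \<Sum>a\<in>Basis. (T b \<bullet> a) * (S a \<bullet> b))"
    if "linear S" for S T :: "'e \<Rightarrow> 'e"
    unfolding trace_endo_def
    by (intro sum.cong refl, subst linear_Basis_expand[OF that]) (simp add: inner_sum_left)
  show ?thesis
    unfolding expand[OF assms(1)] expand[OF assms(2)]
    by (subst sum.swap) (simp add: mult.commute)
qed

text \<open>
  If \<open>L\<close> is the isomorphism with \<open>L u \<bullet> v = G u v\<close>, then \<open>S\<close> is conjugate by \<open>L\<close> to the Euclidean adjoint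
  of \<open>S'\<close>, so the traces agree.
\<close>

lemma trace_endo_adjoint:
  fixes G :: "'e::euclidean_space \<Rightarrow> 'e \<Rightarrow> real"
  assumes G: "bilinear G" "\<And>v. v \<noteq> 0 \<Longrightarrow> G v v > 0"
    and S: "linear S" "linear S'" "\<And>u v. G (S u) v = G u (S' v)"
  shows "trace_endo S = trace_endo S'"
proof -
  have lin: "linear (\<lambda>u. G u v)" "linear (G u)" for u v
    using G(1) by (simp_all add: bilinear_def)
  define L where "L u = (\<Sum>b\<in>Basis. G u b *\<^sub>R b)" for u
  have L: "linear L"
    unfolding L_def using linear_add[OF lin(1)] linear_cmul[OF lin(1)]
    by (intro linearI) (simp_all add: scaleR_left_distrib sum.distrib scaleR_sum_right)
  have Lin: "L u \<bullet> v = G u v" for u v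
    using linear_Basis_expand[OF lin(2), of u v] by (simp add: L_def inner_sum_left inner_sum_right mult.commute inner_commute)
  have "inj L"
    using G(2) Lin by (intro linear_injective_0[OF L, THEN iffD2]) (metis inner_zero_left less_irrefl)
  then obtain M where M: "linear M" "\<And>v. M (L v) = v" "\<And>v. L (M v) = v"
    using linear_injective_isomorphism[OF L] by blast
  have "L (S u) = adjoint S' (L u)" for u
  proof (rule euclidean_eqI)
    fix b :: 'e
    show "L (S u) \<bullet> b = adjoint S' (L u) \<bullet> b"
      using adjoint_works[OF S(2), of b "L u"] by (simp add: Lin S(3) inner_commute[of _ "L u"] inner_commute[of b])
  qed
  then have "S = (\<lambda>w. M (adjoint S' (L w)))" using M by metis
  then have "trace_endo S = trace_endo (\<lambda>w. M (adjoint S' (L w)))" by simp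
  also have "\<dots> = trace_endo (\<lambda>w. adjoint S' (L (M w)))"
    using trace_endo_commute[OF M(1) linear_compose[OF L adjoint_linear[OF S(2)]]] by simp
  also have "\<dots> = trace_endo S'"
    using adjoint_works[OF S(2)] by (simp add: trace_endo_def M inner_commute)
  finally show ?thesis .
qed

section \<open>The Levi-Civita connection\<close>

locale riemannian = smooth_manifold A for A :: "('m::t2_space, 'e::euclidean_space) chart set" +
  fixes g :: "'m \<Rightarrow> 'e \<Rightarrow> 'e \<Rightarrow> real" and D :: "('m \<Rightarrow> 'e) \<Rightarrow> ('m \<Rightarrow> 'e) \<Rightarrow> 'm \<Rightarrow> 'e"
  assumes metric: "riemannian_metric A g" and connection: "levi_civita A g D"
begin

abbreviation "VF \<equiv> vector_field A"
abbreviation "SF \<equiv> smooth_function A"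
abbreviation "dv \<equiv> deriv_along A"
abbreviation "bracket \<equiv> lie_bracket A"
abbreviation "R \<equiv> curvature A D"

lemma g_bilinear: "bilinear (g p)" and g_commute: "g p u v = g p v u"
  and g_pos: "v \<noteq> 0 \<Longrightarrow> g p v v > 0"
  and g_smooth: "VF X \<Longrightarrow> VF Y \<Longrightarrow> SF (\<lambda>p. g p (X p) (Y p))"
  using metric by (auto simp: riemannian_metric_def)

lemma g_linear: "linear (\<lambda>u. g p u v)" "linear (g p u)"
  using g_bilinear by (simp_all add: bilinear_def)

lemmas g_simps =
  linear_add[OF g_linear(1)] linear_diff[OF g_linear(1)] linear_neg[OF g_linear(1)]
  linear_cmul[OF g_linear(1)] linear_0[OF g_linear(1)]
  linear_add[OF g_linear(2)] linear_diff[OF g_linear(2)] linear_neg[OF g_linear(2)]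
  linear_cmul[OF g_linear(2)] linear_0[OF g_linear(2)]

lemma g_eqI:
  assumes "\<And>w. g p u w = g p v w"
  shows "u = v"
proof (rule ccontr)
  assume "u \<noteq> v"
  then have "g p (u - v) (u - v) > 0" by (intro g_pos) simp
  with assms[of "u - v"] show False by (simp add: g_simps)
qed

lemma D_vf: "VF X \<Longrightarrow> VF Y \<Longrightarrow> VF (D X Y)"
  using connection by (auto simp: levi_civita_def affine_connection_def)

lemma D_add:
  assumes "VF X" "VF Y" "VF Z"
  shows "D (\<lambda>p. X p + Y p) Z = (\<lambda>p. D X Z p + D Y Z p)"
    and "D Z (\<lambda>p. X p + Y p) = (\<lambda>p. D Z X p + D Z Y p)"
  using connection assms unfolding levi_civita_def affine_connection_def by blast+

lemma D_scale:
  assumes "SF h" "VF X" "VF Y"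
  shows "D (\<lambda>p. h p *\<^sub>R X p) Y = (\<lambda>p. h p *\<^sub>R D X Y p)"
    and "D X (\<lambda>p. h p *\<^sub>R Y p) = (\<lambda>p. dv X h p *\<^sub>R Y p + h p *\<^sub>R D X Y p)"
  using connection assms unfolding levi_civita_def affine_connection_def by blast+

lemma dv_const: "dv X (\<lambda>q. k) = (\<lambda>p. 0)"
  by (simp add: deriv_along_def differential_const fun_eq_iff)

lemma dv_add: "SF h \<Longrightarrow> SF k \<Longrightarrow> dv X (\<lambda>q. h q + k q) = (\<lambda>p. dv X h p + dv X k p)"
  by (simp add: deriv_along_def differential_add fun_eq_iff)

lemma dv_mult: "SF h \<Longrightarrow> SF k \<Longrightarrow> dv X (\<lambda>q. h q * k q) = (\<lambda>p. h p * dv X k p + dv X h p * k p)"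
  by (simp add: deriv_along_def differential_mult fun_eq_iff)

lemma dv_cmul: "SF h \<Longrightarrow> dv X (\<lambda>q. k * h q) = (\<lambda>p. k * dv X h p)"
  using dv_mult[OF smooth_function_const, where X = X and k = h] by (simp add: dv_const)

lemma dv_minus: "SF h \<Longrightarrow> dv X (\<lambda>q. - h q) = (\<lambda>p. - dv X h p)"
  using dv_cmul[where h = h and X = X and k = "-1"] by simp

lemma dv_diff: "SF h \<Longrightarrow> SF k \<Longrightarrow> dv X (\<lambda>q. h q - k q) = (\<lambda>p. dv X h p - dv X k p)"
  using dv_add[OF _ smooth_function_minus, where X = X] by (simp add: dv_minus)

lemma dv_sum:
  "finite I \<Longrightarrow> (\<And>i. i \<in> I \<Longrightarrow> SF (h i)) \<Longrightarrow> dv X (\<lambda>q. \<Sum>i\<in>I. h i q) p = (\<Sum>i\<in>I. dv X (h i) p)"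
  by (induction I rule: finite_induct)
     (auto simp: dv_const dv_add smooth_function_sum)

lemma D_cmul:
  assumes "VF X" "VF Y"
  shows "D (\<lambda>p. k *\<^sub>R X p) Y = (\<lambda>p. k *\<^sub>R D X Y p)"
    and "D X (\<lambda>p. k *\<^sub>R Y p) = (\<lambda>p. k *\<^sub>R D X Y p)"
  using D_scale[OF smooth_function_const assms] by (simp_all add: dv_const)

lemma D_minus:
  assumes "VF X" "VF Y"
  shows "D (\<lambda>p. - X p) Y = (\<lambda>p. - D X Y p)" and "D X (\<lambda>p. - Y p) = (\<lambda>p. - D X Y p)"
  using D_cmul[OF assms, where k = "-1"] by simp_all

lemma D_diff:
  assumes "VF X" "VF Y" "VF Z"
  shows "D (\<lambda>p. X p - Y p) Z = (\<lambda>p. D X Z p - D Y Z p)"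
    and "D Z (\<lambda>p. X p - Y p) = (\<lambda>p. D Z X p - D Z Y p)"
  using D_add[OF assms(1) vector_field_minus[OF assms(2)] assms(3)] assms
  by (simp_all add: D_minus)

lemma D_zero:
  assumes "VF Y"
  shows "D (\<lambda>p. 0) Y = (\<lambda>p. 0)" "D Y (\<lambda>p. 0) = (\<lambda>p. 0)"
  using D_cmul[OF vector_field_zero assms, where k = 0] D_cmul[OF assms vector_field_zero, where k = 0] by simp_all

lemma D_sum:
  assumes "VF X" "finite I" "\<And>i. i \<in> I \<Longrightarrow> VF (Y i)"
  shows "D X (\<lambda>q. \<Sum>i\<in>I. Y i q) p = (\<Sum>i\<in>I. D X (Y i) p)"
  using assms(2,3)
  by (induction I rule: finite_induct)
     (auto simp: D_zero D_add assms(1) vector_field_sum)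

lemma bracket_eq: "VF X \<Longrightarrow> VF Y \<Longrightarrow> bracket X Y = (\<lambda>p. D X Y p - D Y X p)"
  using connection by (simp add: levi_civita_def fun_eq_iff)

lemma bracket_vf: "VF X \<Longrightarrow> VF Y \<Longrightarrow> VF (bracket X Y)"
  by (simp add: bracket_eq vector_field_diff D_vf)

lemma dv_metric:
  "VF X \<Longrightarrow> VF Y \<Longrightarrow> VF Z \<Longrightarrow>
    dv X (\<lambda>q. g q (Y q) (Z q)) = (\<lambda>p. g p (D X Y p) (Z p) + g p (Y p) (D X Z p))"
  using connection by (simp add: levi_civita_def fun_eq_iff)

lemma dv_bracket:
  "SF h \<Longrightarrow> VF X \<Longrightarrow> VF Y \<Longrightarrow> dv (bracket X Y) h = (\<lambda>p. dv X (dv Y h) p - dv Y (dv X h) p)"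
  by (simp add: deriv_along_lie_bracket fun_eq_iff)

text \<open>
  As derivations, brackets are commutators, for which the Jacobi identity is immediate.
\<close>

lemma jacobi:
  assumes "VF X" "VF Y" "VF Z"
  shows "bracket X (bracket Y Z) p + bracket Y (bracket Z X) p + bracket Z (bracket X Y) p = 0"
proof (rule differential_separates)
  fix h assume h: "SF h"
  interpret linear "differential A h p" by (rule differential_linear[OF h])
  have dd: "differential A h p (bracket U V p) = dv (bracket U V) h p" for U V
    by (simp add: deriv_along_def)
  show "differential A h p (bracket X (bracket Y Z) p + bracket Y (bracket Z X) p + bracket Z (bracket X Y) p)
      = differential A h p 0"
    using assms h
    by (simp add: add dd zero dv_bracket bracket_vf dv_diff smooth_function_deriv_along)
qed

section \<open>Curvature\<close>

text \<open>
  Near \<open>p\<close> the field is expanded in a global frame; linearity over smooth functions turns \<open>F X\<close> into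
  a combination of the fixed values \<open>F (E b)\<close> with the components of \<open>X p\<close> as coefficients.
\<close>

lemma tensorial:
  fixes F :: "('m \<Rightarrow> 'e) \<Rightarrow> 'b::real_vector"
  assumes add: "\<And>X Y. VF X \<Longrightarrow> VF Y \<Longrightarrow> F (\<lambda>q. X q + Y q) = F X + F Y"
    and scale: "\<And>h X. SF h \<Longrightarrow> VF X \<Longrightarrow> F (\<lambda>q. h q *\<^sub>R X q) = h p *\<^sub>R F X"
    and XY: "VF X" "VF Y" "X p = Y p"
  shows "F X = F Y"
proof -
  obtain \<phi> E \<Omega> where "frame_at p \<phi> E \<Omega>" using local_frame by blast
  note phi = frame_atD(1-3)[OF this] and E = frame_atD(4,5)[OF this]
    and Omega = frame_atD(6,7)[OF this] and rep = frame_atD(8)[OF this]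
  have zero: "F (\<lambda>q. 0) = 0"
    using scale[OF smooth_function_const vector_field_zero, of 0] by simp
  have sum: "F (\<lambda>q. \<Sum>i\<in>I. Z i q) = (\<Sum>i\<in>I. F (Z i))"
    if "finite I" "\<And>i. i \<in> I \<Longrightarrow> VF (Z i)" for I :: "'e set" and Z
    using that by (induction I rule: finite_induct) (auto simp: zero add vector_field_sum)
  have *: "F Z = (\<Sum>b\<in>Basis. \<Omega> b p (Z p) *\<^sub>R F (E b))" if Z: "VF Z" for Z
  proof -
    have "F Z = F (\<lambda>q. (\<phi> q * \<phi> q) *\<^sub>R Z q)"
      using scale[OF smooth_function_mult[OF phi(1) phi(1)] Z] phi(2) by simp
    also have "\<dots> = F (\<lambda>q. \<Sum>b\<in>Basis. \<Omega> b q (Z q) *\<^sub>R E b q)" by (simp add: rep)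
    also have "\<dots> = (\<Sum>b\<in>Basis. F (\<lambda>q. \<Omega> b q (Z q) *\<^sub>R E b q))"
      by (intro sum vector_field_scale Omega(2) Z E(1)) auto
    also have "\<dots> = (\<Sum>b\<in>Basis. \<Omega> b p (Z p) *\<^sub>R F (E b))"
      by (simp add: scale[OF Omega(2)[OF Z] E(1)])
    finally show ?thesis .
  qed
  show ?thesis using *[OF XY(1)] *[OF XY(2)] XY(3) by simp
qed

lemma R_vf: "VF X \<Longrightarrow> VF Y \<Longrightarrow> VF Z \<Longrightarrow> VF (R X Y Z)"
proof -
  assume "VF X" "VF Y" "VF Z"
  then have "VF (\<lambda>p. D X (D Y Z) p - D Y (D X Z) p - D (bracket X Y) Z p)"
    by (intro vector_field_diff D_vf bracket_vf)
  then show ?thesis by (simp add: curvature_def[abs_def])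
qed

lemma R_skew: 
  assumes "VF X" "VF Y" "VF Z"
  shows "R X Y Z p = - R Y X Z p"
proof -
  have "bracket X Y = (\<lambda>p. - bracket Y X p)" using assms by (simp add: bracket_eq)
  then have "D (bracket X Y) Z p = - D (bracket Y X) Z p"
    using assms by (simp add: D_minus bracket_vf)
  then show ?thesis by (simp add: curvature_def)
qed

lemma R_add1:
  assumes "VF X" "VF X'" "VF Y" "VF Z"
  shows "R (\<lambda>p. X p + X' p) Y Z p = R X Y Z p + R X' Y Z p"
  using assms by (simp add: curvature_def bracket_eq D_add D_diff D_vf vector_field_add vector_field_diff)

lemma R_scale1:
  assumes "SF h" "VF X" "VF Y" "VF Z"
  shows "R (\<lambda>p. h p *\<^sub>R X p) Y Z p = h p *\<^sub>R R X Y Z p"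
proof -
  have "bracket (\<lambda>p. h p *\<^sub>R X p) Y = (\<lambda>p. h p *\<^sub>R bracket X Y p - dv Y h p *\<^sub>R X p)"
    using assms by (simp add: bracket_eq D_scale vector_field_scale algebra_simps)
  then have "D (bracket (\<lambda>p. h p *\<^sub>R X p) Y) Z p = h p *\<^sub>R D (bracket X Y) Z p - dv Y h p *\<^sub>R D X Z p"
    using assms by (simp add: D_diff D_scale bracket_vf vector_field_scale smooth_function_deriv_along)
  then show ?thesis
    using assms by (simp add: curvature_def D_scale D_vf algebra_simps)
qed

lemma R_add3:
  assumes "VF X" "VF Y" "VF Z" "VF Z'"
  shows "R X Y (\<lambda>p. Z p + Z' p) p = R X Y Z p + R X Y Z' p"
  using assms by (simp add: curvature_def D_add D_vf bracket_vf)

lemma R_scale3: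
  assumes "SF h" "VF X" "VF Y" "VF Z"
  shows "R X Y (\<lambda>p. h p *\<^sub>R Z p) p = h p *\<^sub>R R X Y Z p"
  using assms
  by (simp add: curvature_def D_scale D_add D_vf bracket_vf vector_field_scale smooth_function_deriv_along
      dv_bracket algebra_simps)

lemma R_add2:
  assumes "VF X" "VF Y" "VF Y'" "VF Z"
  shows "R X (\<lambda>p. Y p + Y' p) Z p = R X Y Z p + R X Y' Z p"
  using assms R_skew[of X] by (simp add: R_add1 vector_field_add)

lemma R_scale2:
  assumes "SF h" "VF X" "VF Y" "VF Z"
  shows "R X (\<lambda>p. h p *\<^sub>R Y p) Z p = h p *\<^sub>R R X Y Z p"
  using assms R_skew[of X] by (simp add: R_scale1 vector_field_scale)

text \<open>
  The curvature is tensorial in each argument, so the extensions in \<open>curvature_at\<close> may be replaced by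
  the given fields.
\<close>

lemma R_pointwise:
  assumes "VF X" "VF Y" "VF Z"
  shows "R X Y Z p = curvature_at A D p (X p) (Y p) (Z p)"
proof -
  let ?e = "extension A p"
  have "R X Y Z p = R (?e (X p)) Y Z p"
    by (rule tensorial[where F = "\<lambda>X. R X Y Z p" and p = p])
       (simp_all add: assms extension R_add1 R_scale1)
  also have "\<dots> = R (?e (X p)) (?e (Y p)) Z p"
    by (rule tensorial[where F = "\<lambda>Y. R (?e (X p)) Y Z p" and p = p])
       (simp_all add: assms extension R_add2 R_scale2)
  also have "\<dots> = R (?e (X p)) (?e (Y p)) (?e (Z p)) p"
    by (rule tensorial[where F = "\<lambda>Z. R (?e (X p)) (?e (Y p)) Z p" and p = p])
       (simp_all add: assms extension R_add3 R_scale3)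
  finally show ?thesis by (simp add: curvature_at_def)
qed

abbreviation "K \<equiv> curvature_at A D"

lemma K_linear:
  "linear (\<lambda>u. K p u v w)" "linear (\<lambda>v. K p u v w)" "linear (\<lambda>w. K p u v w)"
proof -
  let ?e = "extension A p"
  have e: "VF (?e x)" "?e x p = x" "VF (\<lambda>q. ?e x q + ?e y q)" "VF (\<lambda>q. k *\<^sub>R ?e x q)" for x y k
    by (simp_all add: extension vector_field_add vector_field_cmul)
  have K: "K p (X p) (Y p) (Z p) = R X Y Z p" if "VF X" "VF Y" "VF Z" for X Y Z
    using R_pointwise[OF that] by simp
  have K0: "K p x y z = R (?e x) (?e y) (?e z) p" for x y z
    by (simp add: curvature_at_def)
  show "linear (\<lambda>u. K p u v w)"
  proof (rule linearI)
    show "K p (x + y) v w = K p x v w + K p y v w" for x y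
      using K[OF e(3)[of x y] e(1)[of v] e(1)[of w]] by (simp add: e R_add1 K0[symmetric])
    show "K p (k *\<^sub>R x) v w = k *\<^sub>R K p x v w" for k x
      using K[OF e(4)[of k x] e(1)[of v] e(1)[of w]]
      by (simp add: e R_scale1[OF smooth_function_const] K0[symmetric])
  qed
  show "linear (\<lambda>v. K p u v w)"
  proof (rule linearI)
    show "K p u (x + y) w = K p u x w + K p u y w" for x y
      using K[OF e(1)[of u] e(3)[of x y] e(1)[of w]] by (simp add: e R_add2 K0[symmetric])
    show "K p u (k *\<^sub>R x) w = k *\<^sub>R K p u x w" for k x
      using K[OF e(1)[of u] e(4)[of k x] e(1)[of w]]
      by (simp add: e R_scale2[OF smooth_function_const] K0[symmetric])
  qed
  show "linear (\<lambda>w. K p u v w)"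
  proof (rule linearI)
    show "K p u v (x + y) = K p u v x + K p u v y" for x y
      using K[OF e(1)[of u] e(1)[of v] e(3)[of x y]] by (simp add: e R_add3 K0[symmetric])
    show "K p u v (k *\<^sub>R x) = k *\<^sub>R K p u v x" for k x
      using K[OF e(1)[of u] e(1)[of v] e(4)[of k x]]
      by (simp add: e R_scale3[OF smooth_function_const] K0[symmetric])
  qed
qed

lemma K_skew: "K p u v w = - K p v u w"
  using R_skew[of "extension A p u" "extension A p v" "extension A p w" p]
  by (simp add: curvature_at_def extension)

text \<open>
  For vector fields, torsion-freeness turns the cyclic sum into the Jacobi identity.
\<close>

lemma K_bianchi: "K p u v w + K p v w u + K p w u v = 0"
proof -
  have "R X Y Z p + R Y Z X p + R Z X Y p = 0" if vf: "VF X" "VF Y" "VF Z" for X Y Z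
  proof -
    have *: "D U (D V W) p - D U (D W V) p = bracket U (bracket V W) p + D (bracket V W) U p"
      if "VF U" "VF V" "VF W" for U V W
      using that by (simp add: bracket_eq[of U "bracket V W"] bracket_vf) (simp add: bracket_eq D_diff D_vf)
    show ?thesis
      using *[OF vf(1,2,3)] *[OF vf(2,3,1)] *[OF vf(3,1,2)] jacobi[OF vf, of p]
      unfolding curvature_def by (simp add: algebra_simps)
  qed
  from this[of "extension A p u" "extension A p v" "extension A p w"] show ?thesis
    by (simp add: curvature_at_def extension)
qed

text \<open>
  The commutator identity for the derivations \<open>X\<close>, \<open>Y\<close> and \<open>[X, Y]\<close>, applied to the function \<open>g(Z, W)\<close>.
\<close>

lemma K_metric: "g p (K p u v w) z = - g p w (K p u v z)"
proof -
  let ?e = "extension A p"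
  define X Y Z W where "X = ?e u" and "Y = ?e v" and "Z = ?e w" and "W = ?e z"
  have vf: "VF X" "VF Y" "VF Z" "VF W" by (simp_all add: X_def Y_def Z_def W_def extension)
  have second: "dv U (dv V (\<lambda>q. g q (Z q) (W q))) p = g p (D U (D V Z) p) (W p) + g p (D V Z p) (D U W p)
      + g p (D U Z p) (D V W p) + g p (Z p) (D U (D V W) p)" if "VF U" "VF V" for U V
    using that vf by (simp add: dv_metric dv_add g_smooth D_vf)
  have "dv (bracket X Y) (\<lambda>q. g q (Z q) (W q)) p = dv X (dv Y (\<lambda>q. g q (Z q) (W q))) p - dv Y (dv X (\<lambda>q. g q (Z q) (W q))) p"
    using vf by (simp add: dv_bracket g_smooth)
  then have "g p (R X Y Z p) (W p) = - g p (Z p) (R X Y W p)"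
    unfolding second[OF vf(1,2)] second[OF vf(2,1)] dv_metric[OF bracket_vf[OF vf(1,2)] vf(3,4)]
    by (simp add: curvature_def g_simps)
  then show ?thesis by (simp add: curvature_at_def X_def Y_def Z_def W_def extension)
qed

lemma K_pair: "g p (K p u v w) z = g p (K p w z u) v"
proof -
  have b: "g p (K p a b c) d + g p (K p b c a) d + g p (K p c a b) d = 0" for a b c d
    using arg_cong[OF K_bianchi[of p a b c], of "\<lambda>x. g p x d"] by (simp add: g_simps)
  have s: "g p (K p a b c) d = - g p (K p b a c) d" for a b c d
    by (subst K_skew) (simp add: g_simps)
  have m: "g p (K p a b c) d = - g p (K p a b d) c" for a b c d
    using K_metric[of p a b c d] by (simp add: g_commute)
  \<comment> \<open>The four cyclic identities belong to four faces of an octahedron with the curvature components at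
    its vertices; adding two of them and subtracting the other two leaves twice the claim.\<close>
  show ?thesis
    using b[of u v w z] b[of v w z u] b[of w z u v] b[of z u v w]
      m[of u v z w] m[of v w z u] m[of w z v u] s[of u w z v] m[of w u z v] s[of v z u w]
      m[of z v u w] m[of z u v w]
    by linarith
qed

text \<open>
  The derivative of the curvature is expressed by commutators of operators on vector fields, which avoids a
  covariant derivative of tensors: the third-order terms cancel cyclically, and the rest is the Jacobi
  identity.
\<close>

lemma second_bianchi:
  assumes vf: "VF X" "VF Y" "VF Z" "VF W"
  shows "(D X (R Y Z W) p - R Y Z (D X W) p + R X (bracket Y Z) W p)
       + (D Y (R Z X W) p - R Z X (D Y W) p + R Y (bracket Z X) W p)
       + (D Z (R X Y W) p - R X Y (D Z W) p + R Z (bracket X Y) W p) = 0"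
proof -
  have *: "D U (R V T W) p - R V T (D U W) p + R U (bracket V T) W p =
     D U (D V (D T W)) p - D U (D T (D V W)) p - D V (D T (D U W)) p + D T (D V (D U W)) p
     - D (bracket U (bracket V T)) W p" if "VF U" "VF V" "VF T" for U V T
  proof -
    have "D U (R V T W) p = D U (D V (D T W)) p - D U (D T (D V W)) p - D U (D (bracket V T) W) p"
      using that vf by (simp add: curvature_def[abs_def] D_diff D_vf bracket_vf vector_field_diff)
    then show ?thesis by (simp add: curvature_def)
  qed
  have sum: "D (\<lambda>p. U p + V p + T p) W = (\<lambda>p. D U W p + D V W p + D T W p)"
    if "VF U" "VF V" "VF T" for U V T
    using that vf by (simp add: D_add(1) vector_field_add)
  have "D (\<lambda>p. bracket X (bracket Y Z) p + bracket Y (bracket Z X) p + bracket Z (bracket X Y) p) W p = 0"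
    using vf by (simp add: jacobi D_zero)
  then have "D (bracket X (bracket Y Z)) W p + D (bracket Y (bracket Z X)) W p + D (bracket Z (bracket X Y)) W p = 0"
    using vf by (simp add: sum bracket_vf)
  then show ?thesis
    unfolding *[OF vf(1-3)] *[OF vf(2,3,1)] *[OF vf(3,1,2)]
    by (simp add: algebra_simps)
qed

text \<open>
  The hypothesis on \<open>S\<close> says that \<open>S = \<nabla>\<^sub>W T\<close> at \<open>p\<close>. In a frame, the derivatives of the frame fields and
  those of the coframe contribute opposite terms to the derivative of the trace.
\<close>

lemma dv_trace:
  assumes T: "tensor_11 A T" "SF (\<lambda>q. trace_endo (T q))" and W: "VF W"
    and S: "\<And>Y. VF Y \<Longrightarrow> D W (\<lambda>q. T q (Y q)) p - T p (D W Y p) = S (Y p)"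
  shows "dv W (\<lambda>q. trace_endo (T q)) p = trace_endo S"
proof -
  obtain \<phi> E \<Omega> where "frame_at p \<phi> E \<Omega>" using local_frame by blast
  note phi = frame_atD(1-3)[OF this] and E = frame_atD(4,5)[OF this]
    and Omega = frame_atD(6,7)[OF this] and rep = frame_atD(8)[OF this]
  define \<Phi> where "\<Phi> q = \<phi> q * \<phi> q" for q
  have Phi: "SF \<Phi>" "\<Phi> p = 1" "dv W \<Phi> p = 0"
    using phi by (simp_all add: \<Phi>_def[abs_def] smooth_function_mult dv_mult) (simp add: deriv_along_def)
  have lin: "linear (T q)" for q using T(1) by (simp add: tensor_11_def)
  have TE: "VF (\<lambda>q. T q (E b q))" for b using T(1) E(1) by (simp add: tensor_11_def)
  have Omega_p: "\<Omega> b p v = v \<bullet> b" if "b \<in> Basis" for b v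
  proof -
    have "v \<bullet> b = (\<Sum>a\<in>Basis. \<Omega> a p v *\<^sub>R a) \<bullet> b" using rep[of p v] by (simp add: phi(2) E(2))
    then show ?thesis using that by (simp add: inner_sum_left inner_Basis if_distrib cong: if_cong)
  qed
  \<comment> \<open>The derivative of the coframe, found by differentiating the frame expansion of \<open>Y\<close>.\<close>
  have dOmega: "dv W (\<lambda>q. \<Omega> b q (Y q)) p = D W Y p \<bullet> b - (\<Sum>a\<in>Basis. (Y p \<bullet> a) * (D W (E a) p \<bullet> b))"
    if b: "b \<in> Basis" and Y: "VF Y" for b Y
  proof -
    have "D W Y p = D W (\<lambda>q. \<Phi> q *\<^sub>R Y q) p"
      using D_scale(2)[OF Phi(1) W Y] Phi by simp
    also have "\<dots> = D W (\<lambda>q. \<Sum>a\<in>Basis. \<Omega> a q (Y q) *\<^sub>R E a q) p" by (simp add: \<Phi>_def rep)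
    also have "\<dots> = (\<Sum>a\<in>Basis. D W (\<lambda>q. \<Omega> a q (Y q) *\<^sub>R E a q) p)"
      by (intro D_sum W vector_field_scale Omega(2) Y E(1)) auto
    also have "\<dots> = (\<Sum>a\<in>Basis. dv W (\<lambda>q. \<Omega> a q (Y q)) p *\<^sub>R a + (Y p \<bullet> a) *\<^sub>R D W (E a) p)"
      by (intro sum.cong refl) (simp add: D_scale(2)[OF Omega(2)[OF Y] W E(1)] E(2) Omega_p)
    finally have "D W Y p \<bullet> b = (\<Sum>a\<in>Basis. dv W (\<lambda>q. \<Omega> a q (Y q)) p * (a \<bullet> b) + (Y p \<bullet> a) * (D W (E a) p \<bullet> b))"
      by (simp add: inner_sum_left inner_add_left)
    also have "\<dots> = (\<Sum>a\<in>Basis. dv W (\<lambda>q. \<Omega> a q (Y q)) p * (a \<bullet> b))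
        + (\<Sum>a\<in>Basis. (Y p \<bullet> a) * (D W (E a) p \<bullet> b))" by (rule sum.distrib)
    also have "(\<Sum>a\<in>Basis. dv W (\<lambda>q. \<Omega> a q (Y q)) p * (a \<bullet> b)) = dv W (\<lambda>q. \<Omega> b q (Y q)) p"
    proof -
      have "(\<Sum>a\<in>Basis. dv W (\<lambda>q. \<Omega> a q (Y q)) p * (a \<bullet> b))
          = (\<Sum>a\<in>Basis. if a = b then dv W (\<lambda>q. \<Omega> b q (Y q)) p else 0)"
        using b by (intro sum.cong refl) (simp add: inner_Basis)
      then show ?thesis using b by simp
    qed
    finally show ?thesis by simp
  qed
  have "dv W (\<lambda>q. trace_endo (T q)) p = dv W (\<lambda>q. \<Phi> q * trace_endo (T q)) p"
    using dv_mult[OF Phi(1) T(2)] Phi by simp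
  also have "\<dots> = dv W (\<lambda>q. \<Sum>b\<in>Basis. \<Omega> b q (T q (E b q))) p"
    by (simp add: \<Phi>_def trace_endo_frame[OF lin Omega(1) rep])
  also have "\<dots> = (\<Sum>b\<in>Basis. dv W (\<lambda>q. \<Omega> b q (T q (E b q))) p)"
    by (intro dv_sum Omega(2) TE) auto
  also have "\<dots> = (\<Sum>b\<in>Basis. D W (\<lambda>q. T q (E b q)) p \<bullet> b)
      - (\<Sum>b\<in>Basis. \<Sum>a\<in>Basis. (T p b \<bullet> a) * (D W (E a) p \<bullet> b))"
    by (simp add: dOmega[OF _ TE] E(2) sum_subtractf)
  also have "(\<Sum>b\<in>Basis. \<Sum>a\<in>Basis. (T p b \<bullet> a) * (D W (E a) p \<bullet> b)) = (\<Sum>a\<in>Basis. T p (D W (E a) p) \<bullet> a)"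
    by (subst sum.swap, intro sum.cong refl, subst linear_Basis_expand[OF lin])
       (simp add: inner_sum_left mult.commute)
  also have "(\<Sum>b\<in>Basis. D W (\<lambda>q. T q (E b q)) p \<bullet> b) - \<dots> = trace_endo S"
    by (simp add: sum_subtractf[symmetric] inner_diff_left[symmetric] S E trace_endo_def)
  finally show ?thesis .
qed

end

section \<open>Weak \<open>\<beta>\<close>-Kenmotsu structures\<close>

locale weak_kenmotsu = riemannian A g D
  for A :: "('m::{t2_space, second_countable_topology}, 'e::euclidean_space) chart set"
    and g :: "'m \<Rightarrow> 'e \<Rightarrow> 'e \<Rightarrow> real" and D :: "('m \<Rightarrow> 'e) \<Rightarrow> ('m \<Rightarrow> 'e) \<Rightarrow> 'm \<Rightarrow> 'e" +
  fixes n :: nat and \<beta> :: real and f Q :: "'m \<Rightarrow> 'e \<Rightarrow> 'e" and \<xi> :: "'m \<Rightarrow> 'e"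
    and \<eta> :: "'m \<Rightarrow> 'e \<Rightarrow> real"
  assumes kenmotsu: "weak_beta_kenmotsu n \<beta> A f Q \<xi> \<eta> g D"
begin

lemma contact_structure: "weak_almost_contact_metric n A f Q \<xi> \<eta> g"
  using kenmotsu by (simp add: weak_beta_kenmotsu_def)

lemma beta_nonzero: "\<beta> \<noteq> 0"
  using kenmotsu by (simp add: weak_beta_kenmotsu_def)

lemma n_pos: "n \<ge> 1" and dim: "DIM('e) = 2 * n + 1" and connected_UNIV: "connected (UNIV :: 'm set)"
  and rank_f: "dim (range (f p)) = 2 * n" and xi_vf: "VF \<xi>"
  and eta_smooth: "VF X \<Longrightarrow> SF (\<lambda>q. \<eta> q (X q))"
  and f_vf: "VF X \<Longrightarrow> VF (\<lambda>q. f q (X q))" and Q_vf: "VF X \<Longrightarrow> VF (\<lambda>q. Q q (X q))"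
  and f_linear: "linear (f p)" and Q_linear: "linear (Q p)" and eta_linear: "linear (\<eta> p)"
  and Q_bij: "bij (Q p)" and f_f: "f p (f p v) = - Q p v + \<eta> p v *\<^sub>R \<xi> p"
  and eta_xi: "\<eta> p (\<xi> p) = 1" and Q_xi: "Q p (\<xi> p) = \<xi> p"
  and g_f_f: "g p (f p u) (f p v) = g p u (Q p v) - \<eta> p u * \<eta> p v"
  and f_invariant: "\<eta> p v = 0 \<Longrightarrow> \<eta> p (f p v) = 0"
  using contact_structure
  by (simp_all add: weak_almost_contact_metric_def connected_manifold_def tensor_11_def one_form_def)

lemmas tensor_simps =
  linear_add[OF f_linear] linear_diff[OF f_linear] linear_neg[OF f_linear] linear_cmul[OF f_linear] linear_0[OF f_linear]
  linear_add[OF Q_linear] linear_diff[OF Q_linear] linear_neg[OF Q_linear] linear_cmul[OF Q_linear] linear_0[OF Q_linear]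
  linear_add[OF eta_linear] linear_diff[OF eta_linear] linear_neg[OF eta_linear] linear_cmul[OF eta_linear] linear_0[OF eta_linear]

text \<open>
  On \<open>ker \<eta>\<close> the square of \<open>f\<close> is \<open>- Q\<close>, which is injective.
\<close>

lemma f_injective_on_ker_eta:
  assumes "f p v = 0" "\<eta> p v = 0"
  shows "v = 0"
proof -
  have "Q p v = Q p 0" using f_f[of p v] assms by (simp add: tensor_simps)
  then show ?thesis using Q_bij bij_is_inj injD by metis
qed

text \<open>
  Since \<open>f (f \<xi>) = - Q \<xi> + \<xi> = 0\<close> and \<open>ker \<eta>\<close> is invariant, the \<open>\<xi>\<close>-component \<open>a\<close> of \<open>f \<xi>\<close> satisfies
  \<open>a\<^sup>2 = 0\<close>. So \<open>f \<xi>\<close> lies in \<open>ker \<eta>\<close>, on which \<open>f\<close> is injective.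
\<close>

lemma f_xi: "f p (\<xi> p) = 0"
proof -
  define a where "a = \<eta> p (f p (\<xi> p))"
  define x where "x = f p (\<xi> p) - a *\<^sub>R \<xi> p"
  have ff: "f p (f p (\<xi> p)) = 0" by (simp add: f_f Q_xi eta_xi)
  have x0: "\<eta> p x = 0" by (simp add: x_def tensor_simps eta_xi a_def)
  have fx: "f p x = - a *\<^sub>R f p (\<xi> p)" by (simp add: x_def tensor_simps ff)
  have "a * a = 0" using f_invariant[OF x0] by (simp add: fx tensor_simps a_def)
  then have a: "a = 0" by simp
  with fx have "x = 0" by (intro f_injective_on_ker_eta[OF _ x0]) simp
  with a show ?thesis by (simp add: x_def)
qed

lemma eta_f: "\<eta> p (f p v) = 0"
proof -
  have "\<eta> p (f p (v - \<eta> p v *\<^sub>R \<xi> p)) = 0"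
    by (rule f_invariant) (simp add: tensor_simps eta_xi)
  then show ?thesis by (simp add: tensor_simps f_xi)
qed

lemma g_xi: "g p u (\<xi> p) = \<eta> p u" "g p (\<xi> p) u = \<eta> p u"
  using g_f_f[of p u "\<xi> p"] by (simp_all add: f_xi Q_xi eta_xi g_simps g_commute[of p "\<xi> p"])

text \<open>
  Compatibility of \<open>f\<close> with \<open>g\<close> gives skew-symmetry against vectors \<open>f w\<close>. Since \<open>Q\<close> is onto, every vector is the
  sum of such a vector and a multiple of \<open>\<xi>\<close>, and \<open>\<xi>\<close> is orthogonal to the image of \<open>f\<close>.
\<close>

lemma f_skew: "g p (f p u) v = - g p u (f p v)"
proof -
  define y where "y = v - \<eta> p v *\<^sub>R \<xi> p"
  obtain w where "Q p w = - y" using Q_bij by (metis bij_pointE)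
  then have ffw: "f p (f p w) = y + \<eta> p w *\<^sub>R \<xi> p" by (simp add: f_f)
  have "\<eta> p y = 0" by (simp add: y_def tensor_simps eta_xi)
  then have "\<eta> p w = 0" using eta_f[of p "f p w"] by (simp add: ffw tensor_simps eta_xi)
  with ffw have v: "v = f p (f p w) + \<eta> p v *\<^sub>R \<xi> p" by (simp add: y_def)
  have "g p (f p u) v = g p u (Q p (f p w))"
    by (subst v) (simp add: g_simps g_xi eta_f g_f_f)
  also have "\<dots> = - g p u (f p (f p (f p w)))"
    by (subst f_f) (simp add: eta_f g_simps)
  also have "f p (f p (f p w)) = f p v"
    using arg_cong[OF v, of "f p"] by (simp add: tensor_simps f_xi)
  finally show ?thesis .
qed

lemma trace_f: "trace_endo (f p) = 0"
proof -
  have "trace_endo (f p) = trace_endo (\<lambda>w. - f p w)"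
    by (rule trace_endo_adjoint[OF g_bilinear[of p] g_pos f_linear])
       (auto simp: f_skew g_simps intro!: linear_compose_neg f_linear)
  then show ?thesis by (simp add: trace_endo_minus)
qed

lemma D_f:
  assumes "VF X" "VF Y"
  shows "D X (\<lambda>q. f q (Y q)) = (\<lambda>p. f p (D X Y p) + \<beta> *\<^sub>R (g p (f p (X p)) (Y p) *\<^sub>R \<xi> p - \<eta> p (Y p) *\<^sub>R f p (X p)))"
proof
  fix p
  have "D X (\<lambda>q. f q (Y q)) p - f p (D X Y p)
      = \<beta> *\<^sub>R (g p (f p (X p)) (Y p) *\<^sub>R \<xi> p - \<eta> p (Y p) *\<^sub>R f p (X p))"
    using kenmotsu assms by (simp add: weak_beta_kenmotsu_def)
  then show "D X (\<lambda>q. f q (Y q)) p = f p (D X Y p) + \<beta> *\<^sub>R (g p (f p (X p)) (Y p) *\<^sub>R \<xi> p - \<eta> p (Y p) *\<^sub>R f p (X p))"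
    by (metis add.commute diff_add_cancel)
qed

text \<open>
  Applying the Kenmotsu equation to \<open>\<xi>\<close> determines \<open>f (\<nabla>\<^sub>X \<xi>)\<close>, hence \<open>\<nabla>\<^sub>X \<xi>\<close> up to a multiple of \<open>\<xi>\<close>,
  and this multiple vanishes because \<open>\<xi>\<close> is a unit field.
\<close>

lemma D_xi:
  assumes X: "VF X"
  shows "D X \<xi> = (\<lambda>p. \<beta> *\<^sub>R (X p - \<eta> p (X p) *\<^sub>R \<xi> p))"
proof
  fix p
  define y where "y = D X \<xi> p - \<beta> *\<^sub>R (X p - \<eta> p (X p) *\<^sub>R \<xi> p)"
  have "f p (D X \<xi> p) = \<beta> *\<^sub>R f p (X p)"
    using fun_cong[OF D_f[OF X xi_vf], of p] by (simp add: f_xi D_zero X g_xi eta_f eta_xi)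
  then have fy: "f p y = 0" by (simp add: y_def tensor_simps f_xi)
  have "\<eta> p (D X \<xi> p) = 0"
    using fun_cong[OF dv_metric[OF X xi_vf xi_vf], of p] by (simp add: g_xi eta_xi dv_const)
  then have "\<eta> p y = 0" by (simp add: y_def tensor_simps eta_xi)
  with fy have "y = 0" by (rule f_injective_on_ker_eta)
  then show "D X \<xi> p = \<beta> *\<^sub>R (X p - \<eta> p (X p) *\<^sub>R \<xi> p)" by (simp add: y_def)
qed

lemma dv_eta:
  assumes "VF X" "VF Y"
  shows "dv X (\<lambda>q. \<eta> q (Y q)) = (\<lambda>p. \<eta> p (D X Y p) + \<beta> * (g p (X p) (Y p) - \<eta> p (X p) * \<eta> p (Y p)))"
  using dv_metric[OF assms xi_vf] assms
  by (simp add: g_xi D_xi g_simps g_commute fun_eq_iff algebra_simps)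

lemma D_xi_Q:
  assumes Y: "VF Y"
  shows "D \<xi> (\<lambda>q. Q q (Y q)) = (\<lambda>p. Q p (D \<xi> Y p))"
proof -
  have Q: "Q p v = \<eta> p v *\<^sub>R \<xi> p - f p (f p v)" for p v by (simp add: f_f)
  have Df: "D \<xi> (\<lambda>q. f q (Z q)) = (\<lambda>p. f p (D \<xi> Z p))" if "VF Z" for Z
    using D_f[OF xi_vf that] by (simp add: f_xi g_simps)
  show ?thesis
    using Y by (simp add: Q D_diff D_scale D_xi Df dv_eta vector_field_scale eta_smooth xi_vf f_vf
        eta_xi g_xi tensor_simps)
qed

lemma K_xi3: "K p u v (\<xi> p) = \<beta>\<^sup>2 *\<^sub>R (\<eta> p u *\<^sub>R v - \<eta> p v *\<^sub>R u)"
proof -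
  define X Y where "X = extension A p u" and "Y = extension A p v"
  have vf: "VF X" "VF Y" and at: "X p = u" "Y p = v" by (simp_all add: X_def Y_def extension)
  have DD: "D U (D W \<xi>) p = \<beta> *\<^sub>R (D U W p - (\<eta> p (D U W p) + \<beta> * (g p (U p) (W p) - \<eta> p (U p) * \<eta> p (W p))) *\<^sub>R \<xi> p
      - \<eta> p (W p) *\<^sub>R \<beta> *\<^sub>R (U p - \<eta> p (U p) *\<^sub>R \<xi> p))" if "VF U" "VF W" for U W
  proof -
    have 1: "VF (\<lambda>q. \<eta> q (W q) *\<^sub>R \<xi> q)"
      by (intro vector_field_scale eta_smooth that xi_vf)
    show ?thesis
      by (simp only: D_xi[OF that(2)] D_cmul(2)[OF that(1) vector_field_diff[OF that(2) 1]]
          D_diff(2)[OF that(2) 1 that(1)] D_scale(2)[OF eta_smooth[OF that(2)] that(1) xi_vf]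
          dv_eta[OF that] D_xi[OF that(1)]) (simp add: algebra_simps)
  qed
  have "K p u v (\<xi> p) = R X Y \<xi> p" using R_pointwise[OF vf xi_vf] at by simp
  also have "\<dots> = \<beta>\<^sup>2 *\<^sub>R (\<eta> p u *\<^sub>R v - \<eta> p v *\<^sub>R u)"
    unfolding curvature_def DD[OF vf] DD[OF vf(2,1)] D_xi[OF bracket_vf[OF vf]]
    by (simp add: bracket_eq vf at tensor_simps g_commute[of p v u] algebra_simps power2_eq_square)
  finally show ?thesis .
qed

lemma K_xi1: "K p (\<xi> p) u w = \<beta>\<^sup>2 *\<^sub>R (\<eta> p w *\<^sub>R u - g p u w *\<^sub>R \<xi> p)"
proof (rule g_eqI)
  fix z
  show "g p (K p (\<xi> p) u w) z = g p (\<beta>\<^sup>2 *\<^sub>R (\<eta> p w *\<^sub>R u - g p u w *\<^sub>R \<xi> p)) z"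
    unfolding K_pair[of p "\<xi> p" u w z] K_xi3
    by (simp add: g_simps g_xi g_commute[of p z u] g_commute[of p w u] algebra_simps)
qed

lemma K_xi2: "K p u (\<xi> p) w = \<beta>\<^sup>2 *\<^sub>R (g p u w *\<^sub>R \<xi> p - \<eta> p w *\<^sub>R u)"
  by (subst K_skew) (simp add: K_xi1 algebra_simps)

text \<open>
  The commutator of the curvature with \<open>f\<close> is the skew part of the second covariant derivative of \<open>f\<close>,
  which the Kenmotsu equation and \<open>D_xi\<close> give explicitly.
\<close>

lemma K_f_commutator: "K p u v (f p w) - f p (K p u v w) =
  \<beta>\<^sup>2 *\<^sub>R (g p (f p v) w *\<^sub>R u - g p (f p u) w *\<^sub>R v - g p u w *\<^sub>R f p v + g p v w *\<^sub>R f p u)"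
proof -
  define X Y Z where "X = extension A p u" and "Y = extension A p v" and "Z = extension A p w"
  have vf: "VF X" "VF Y" "VF Z" and at: "X p = u" "Y p = v" "Z p = w"
    by (simp_all add: X_def Y_def Z_def extension)
  \<comment> \<open>Both derivatives of \<open>f Z\<close>, expanded by the Kenmotsu equation.\<close>
  have DD: "D U (D W (\<lambda>q. f q (Z q))) p = f p (D U (D W Z) p)
      + \<beta> *\<^sub>R (g p (f p (U p)) (D W Z p) *\<^sub>R \<xi> p - \<eta> p (D W Z p) *\<^sub>R f p (U p))
      + \<beta> *\<^sub>R ((g p (f p (D U W p) + \<beta> *\<^sub>R (g p (f p (U p)) (W p) *\<^sub>R \<xi> p - \<eta> p (W p) *\<^sub>R f p (U p))) (Z p)
              + g p (f p (W p)) (D U Z p)) *\<^sub>R \<xi> p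
          + g p (f p (W p)) (Z p) *\<^sub>R \<beta> *\<^sub>R (U p - \<eta> p (U p) *\<^sub>R \<xi> p)
          - (\<eta> p (D U Z p) + \<beta> * (g p (U p) (Z p) - \<eta> p (U p) * \<eta> p (Z p))) *\<^sub>R f p (W p)
          - \<eta> p (Z p) *\<^sub>R (f p (D U W p) + \<beta> *\<^sub>R (g p (f p (U p)) (W p) *\<^sub>R \<xi> p - \<eta> p (W p) *\<^sub>R f p (U p))))"
    if UW: "VF U" "VF W" for U W
  proof -
    have fW: "VF (\<lambda>q. f q (W q))" by (rule f_vf[OF UW(2)])
    have 1: "VF (\<lambda>q. g q (f q (W q)) (Z q) *\<^sub>R \<xi> q)" "VF (\<lambda>q. \<eta> q (Z q) *\<^sub>R f q (W q))"
      by (rule vector_field_scale[OF g_smooth[OF fW vf(3)] xi_vf],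
          rule vector_field_scale[OF eta_smooth[OF vf(3)] fW])
    have "D U (D W (\<lambda>q. f q (Z q))) p = D U (\<lambda>q. f q (D W Z q)) p
      + \<beta> *\<^sub>R (D U (\<lambda>q. g q (f q (W q)) (Z q) *\<^sub>R \<xi> q) p - D U (\<lambda>q. \<eta> q (Z q) *\<^sub>R f q (W q)) p)"
      using UW vf 1
      by (simp add: D_f[OF UW(2) vf(3)] D_add D_cmul D_diff f_vf D_vf vector_field_diff vector_field_cmul)
    also have "D U (\<lambda>q. f q (D W Z q)) p = f p (D U (D W Z) p)
      + \<beta> *\<^sub>R (g p (f p (U p)) (D W Z p) *\<^sub>R \<xi> p - \<eta> p (D W Z p) *\<^sub>R f p (U p))"
      using D_f[OF UW(1) D_vf[OF UW(2) vf(3)]] by simp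
    also have "D U (\<lambda>q. g q (f q (W q)) (Z q) *\<^sub>R \<xi> q) p =
        (g p (f p (D U W p) + \<beta> *\<^sub>R (g p (f p (U p)) (W p) *\<^sub>R \<xi> p - \<eta> p (W p) *\<^sub>R f p (U p))) (Z p)
              + g p (f p (W p)) (D U Z p)) *\<^sub>R \<xi> p
          + g p (f p (W p)) (Z p) *\<^sub>R \<beta> *\<^sub>R (U p - \<eta> p (U p) *\<^sub>R \<xi> p)"
      by (simp only: D_scale(2)[OF g_smooth[OF fW vf(3)] UW(1) xi_vf] dv_metric[OF UW(1) fW vf(3)]
          D_f[OF UW] D_xi[OF UW(1)])
    also have "D U (\<lambda>q. \<eta> q (Z q) *\<^sub>R f q (W q)) p =
        (\<eta> p (D U Z p) + \<beta> * (g p (U p) (Z p) - \<eta> p (U p) * \<eta> p (Z p))) *\<^sub>R f p (W p)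
          + \<eta> p (Z p) *\<^sub>R (f p (D U W p) + \<beta> *\<^sub>R (g p (f p (U p)) (W p) *\<^sub>R \<xi> p - \<eta> p (W p) *\<^sub>R f p (U p)))"
      by (simp only: D_scale(2)[OF eta_smooth[OF vf(3)] UW(1) fW] dv_eta[OF UW(1) vf(3)] D_f[OF UW])
    finally show ?thesis by (simp add: algebra_simps)
  qed
  have "K p u v (f p w) - f p (K p u v w) = R X Y (\<lambda>q. f q (Z q)) p - f p (R X Y Z p)"
    using R_pointwise[OF vf(1,2) f_vf[OF vf(3)], of p] R_pointwise[OF vf, of p] at by simp
  also have "\<dots> = \<beta>\<^sup>2 *\<^sub>R (g p (f p v) w *\<^sub>R u - g p (f p u) w *\<^sub>R v - g p u w *\<^sub>R f p v + g p v w *\<^sub>R f p u)"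
    unfolding curvature_def DD[OF vf(1,2)] DD[OF vf(2,1)] D_f[OF bracket_vf[OF vf(1,2)] vf(3)]
    unfolding bracket_eq[OF vf(1,2)] at
    using f_skew[of p u v]
    by (simp add: tensor_simps g_simps g_xi g_commute[of p u "f p v"] algebra_simps power2_eq_square)
  finally show ?thesis .
qed

lemmas K_simps =
  linear_add[OF K_linear(1)] linear_diff[OF K_linear(1)] linear_neg[OF K_linear(1)] linear_cmul[OF K_linear(1)]
  linear_add[OF K_linear(2)] linear_diff[OF K_linear(2)] linear_neg[OF K_linear(2)] linear_cmul[OF K_linear(2)]
  linear_add[OF K_linear(3)] linear_diff[OF K_linear(3)] linear_neg[OF K_linear(3)] linear_cmul[OF K_linear(3)]

section \<open>The Ricci tensor and the \<open>*\<close>-Ricci tensor\<close>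

text \<open>
  In the second Bianchi identity with first argument \<open>\<xi>\<close>, every term except the derivative along \<open>\<xi>\<close> contains a
  curvature with an argument \<open>\<xi>\<close> or a bracket with \<open>\<xi>\<close>; the former are explicit, and the latter contribute
  \<open>\<beta>\<close> times the curvature itself.
\<close>

lemma D_xi_curvature:
  assumes vf: "VF Y" "VF Z" "VF W"
  shows "D \<xi> (R Y Z W) p = R (D \<xi> Y) Z W p + R Y (D \<xi> Z) W p + R Y Z (D \<xi> W) p
    - (2 * \<beta>) *\<^sub>R R Y Z W p - (2 * \<beta>^3) *\<^sub>R (g p (Z p) (W p) *\<^sub>R Y p - g p (Y p) (W p) *\<^sub>R Z p)"
proof -
  have D_R_xi: "D T (R S \<xi> W) p = \<beta>\<^sup>2 *\<^sub>R
     ((g p (D T S p) (W p) + g p (S p) (D T W p)) *\<^sub>R \<xi> p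
       + g p (S p) (W p) *\<^sub>R \<beta> *\<^sub>R (T p - \<eta> p (T p) *\<^sub>R \<xi> p)
      - (\<eta> p (D T W p) + \<beta> * (g p (T p) (W p) - \<eta> p (T p) * \<eta> p (W p))) *\<^sub>R S p
      - \<eta> p (W p) *\<^sub>R D T S p)" if TS: "VF T" "VF S" for T S
  proof -
    have 1: "VF (\<lambda>q. g q (S q) (W q) *\<^sub>R \<xi> q)" "VF (\<lambda>q. \<eta> q (W q) *\<^sub>R S q)"
      by (rule vector_field_scale[OF g_smooth[OF TS(2) vf(3)] xi_vf],
          rule vector_field_scale[OF eta_smooth[OF vf(3)] TS(2)])
    have "R S \<xi> W = (\<lambda>q. \<beta>\<^sup>2 *\<^sub>R (g q (S q) (W q) *\<^sub>R \<xi> q - \<eta> q (W q) *\<^sub>R S q))"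
      using R_pointwise[OF TS(2) xi_vf vf(3)] by (simp add: K_xi2 fun_eq_iff)
    then show ?thesis
      by (simp only: D_cmul(2)[OF TS(1) vector_field_diff[OF 1]] D_diff(2)[OF 1 TS(1)]
          D_scale(2)[OF g_smooth[OF TS(2) vf(3)] TS(1) xi_vf] D_scale(2)[OF eta_smooth[OF vf(3)] TS]
          dv_metric[OF TS vf(3)] dv_eta[OF TS(1) vf(3)] D_xi[OF TS(1)]) (simp add: algebra_simps)
  qed
  have R_swap: "D Z (R \<xi> Y W) p = - D Z (R Y \<xi> W) p"
  proof -
    have "R \<xi> Y W = (\<lambda>q. - R Y \<xi> W q)" using R_skew vf xi_vf by blast
    then show ?thesis using vf xi_vf by (simp add: D_minus R_vf)
  qed
  note b = second_bianchi[OF xi_vf vf, of p]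
  have at: "R X' Y' Z' p = K p (X' p) (Y' p) (Z' p)" if "VF X'" "VF Y'" "VF Z'" for X' Y' Z'
    using R_pointwise[OF that] .
  have br: "bracket Z \<xi> p = \<beta> *\<^sub>R (Z p - \<eta> p (Z p) *\<^sub>R \<xi> p) - D \<xi> Z p"
    "bracket \<xi> Y p = D \<xi> Y p - \<beta> *\<^sub>R (Y p - \<eta> p (Y p) *\<^sub>R \<xi> p)"
    "bracket Y Z p = D Y Z p - D Z Y p"
    using vf xi_vf by (simp_all add: bracket_eq D_xi)
  have "D \<xi> (R Y Z W) p - (K p (D \<xi> Y p) (Z p) (W p) + K p (Y p) (D \<xi> Z p) (W p) + K p (Y p) (Z p) (D \<xi> W p)
    - \<beta> *\<^sub>R K p (Y p) (Z p) (W p) - \<beta> *\<^sub>R K p (Y p) (Z p) (W p)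
    - \<beta>^3 *\<^sub>R (g p (Z p) (W p) *\<^sub>R Y p - g p (Y p) (W p) *\<^sub>R Z p)
    - \<beta>^3 *\<^sub>R (g p (Z p) (W p) *\<^sub>R Y p - g p (Y p) (W p) *\<^sub>R Z p)) = 0"
    using b vf xi_vf K_skew[of p "Z p" "Y p" "W p"] K_skew[of p "Z p" "D \<xi> Y p" "W p"] g_commute[of p "Y p" "Z p"]
    unfolding R_swap D_R_xi[OF vf(1,2)] D_R_xi[OF vf(2,1)]
    by (simp add: at D_vf bracket_vf br K_xi1 K_xi2 K_simps tensor_simps g_simps
        algebra_simps power2_eq_square power3_eq_cube)
  then have eq: "D \<xi> (R Y Z W) p = K p (D \<xi> Y p) (Z p) (W p) + K p (Y p) (D \<xi> Z p) (W p) + K p (Y p) (Z p) (D \<xi> W p)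
    - \<beta> *\<^sub>R K p (Y p) (Z p) (W p) - \<beta> *\<^sub>R K p (Y p) (Z p) (W p)
    - \<beta>^3 *\<^sub>R (g p (Z p) (W p) *\<^sub>R Y p - g p (Y p) (W p) *\<^sub>R Z p)
    - \<beta>^3 *\<^sub>R (g p (Z p) (W p) *\<^sub>R Y p - g p (Y p) (W p) *\<^sub>R Z p)"
    by (simp only: right_minus_eq)
  have two: "(2 * k) *\<^sub>R x = k *\<^sub>R x + k *\<^sub>R x" for k and x :: 'e
    by (simp only: mult_2 scaleR_left_distrib)
  note Dvf = vf[THEN D_vf[OF xi_vf]]
  show ?thesis
    unfolding eq R_pointwise[OF Dvf(1) vf(2,3)] R_pointwise[OF vf(1) Dvf(2) vf(3)] R_pointwise[OF vf(1,2) Dvf(3)] R_pointwise[OF vf]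
    by (simp only: two diff_diff_eq add.assoc)
qed

abbreviation "Ric \<equiv> ricci A D"

lemma Ric_linear: "linear (\<lambda>u. Ric p u v)" "linear (Ric p u)"
  by (intro linearI; simp add: ricci_def K_simps trace_endo_add trace_endo_scale)+

lemmas Ric_simps = 
  linear_add[OF Ric_linear(1)] linear_diff[OF Ric_linear(1)] linear_neg[OF Ric_linear(1)] linear_cmul[OF Ric_linear(1)]
  linear_add[OF Ric_linear(2)] linear_diff[OF Ric_linear(2)] linear_neg[OF Ric_linear(2)] linear_cmul[OF Ric_linear(2)]

lemma trace_endo_metric: "trace_endo (\<lambda>w. g p w u *\<^sub>R v) = g p v u"
  by (rule trace_endo_rank_one[OF g_linear(1)])

lemma Ric_xi: "Ric p u (\<xi> p) = - 2 * real n * \<beta>\<^sup>2 * \<eta> p u"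
  unfolding ricci_def K_xi3 trace_endo_scale trace_endo_diff trace_endo_rank_one[OF eta_linear] trace_endo_id dim
  by (simp add: algebra_simps)

lemma trace_f_K: "trace_endo (\<lambda>w. f p (K p w u v)) = Ric p u (f p v) - (2 * real n - 1) * \<beta>\<^sup>2 * g p (f p u) v"
proof -
  have "f p (K p w u v) = K p w u (f p v) - \<beta>\<^sup>2 *\<^sub>R (g p (f p u) v *\<^sub>R w + g p w (f p v) *\<^sub>R u - g p w v *\<^sub>R f p u + g p u v *\<^sub>R f p w)" for w
    using K_f_commutator[of p w u v] f_skew[of p w v] by (simp add: algebra_simps)
  then have "trace_endo (\<lambda>w. f p (K p w u v)) = Ric p u (f p v)
      - \<beta>\<^sup>2 * (g p (f p u) v * real DIM('e) + g p u (f p v) - g p (f p u) v + g p u v * trace_endo (f p))"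
    by (simp only: trace_endo_diff trace_endo_add trace_endo_scale trace_endo_id trace_endo_metric ricci_def)
  then show ?thesis using f_skew[of p u v] by (simp add: trace_f dim algebra_simps)
qed

text \<open>
  By pair symmetry the endomorphisms \<open>w \<mapsto> R(w, u) v\<close> and \<open>w \<mapsto> R(w, v) u\<close> are adjoint to each other, while \<open>f\<close> is
  skew-adjoint.
\<close>

lemma trace_f_K_antisym: "trace_endo (\<lambda>w. f p (K p w u v)) = - trace_endo (\<lambda>w. f p (K p w v u))"
proof -
  have lin: "linear (\<lambda>w. f p (K p w u v))" "linear (\<lambda>w. - K p (f p w) v u)"
    by (auto intro!: linearI simp: K_simps tensor_simps)
  have "trace_endo (\<lambda>w. f p (K p w u v)) = trace_endo (\<lambda>w. - K p (f p w) v u)"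
  proof (rule trace_endo_adjoint[OF g_bilinear[of p] g_pos lin])
    fix w z
    have "g p (f p (K p w u v)) z = - g p (K p v (f p z) w) u"
      unfolding f_skew K_pair[of p w u v "f p z"] ..
    also have "\<dots> = g p w (K p v (f p z) u)" by (simp add: K_metric)
    also have "\<dots> = g p w (- K p (f p z) v u)" by (subst K_skew) simp
    finally show "g p (f p (K p w u v)) z = g p w (- K p (f p z) v u)" .
  qed auto
  also have "\<dots> = - trace_endo (\<lambda>w. f p (K p w v u))"
    unfolding trace_endo_minus using trace_endo_commute[OF f_linear K_linear(1)] by simp
  finally show ?thesis .
qed

text \<open>
  The first Bianchi identity splits the trace of \<open>R(u, f v) \<circ> f\<close> into two traces of the kind computed in
  \<open>trace_f_K\<close>, which are equal up to sign by antisymmetry; \<open>f\<^sup>2 = - Q + \<eta> \<otimes> \<xi>\<close> then introduces \<open>Q\<close>.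
\<close>

lemma star_ricci_eq: "star_ricci A D f p u v =
  Ric p u (Q p v) + (2 * real n - 1) * \<beta>\<^sup>2 * g p u (Q p v) + \<beta>\<^sup>2 * \<eta> p u * \<eta> p v"
proof -
  have "K p u (f p v) (f p w) = K p (f p w) (f p v) u - K p (f p w) u (f p v)" for w
    using K_bianchi[of p u "f p v" "f p w"] K_skew[of p "f p v" "f p w" u] by (simp add: algebra_simps)
  then have "trace_endo (\<lambda>w. K p u (f p v) (f p w)) =
      trace_endo (\<lambda>w. K p (f p w) (f p v) u) - trace_endo (\<lambda>w. K p (f p w) u (f p v))"
    by (simp add: trace_endo_diff)
  also have "\<dots> = trace_endo (\<lambda>w. f p (K p w (f p v) u)) - trace_endo (\<lambda>w. f p (K p w u (f p v)))"
    using trace_endo_commute[OF f_linear[of p] K_linear(1)] by simp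
  also have "\<dots> = - 2 * trace_endo (\<lambda>w. f p (K p w u (f p v)))"
    using trace_f_K_antisym[of p "f p v" u] by simp
  finally have "star_ricci A D f p u v = (2 * real n - 1) * \<beta>\<^sup>2 * g p (f p u) (f p v) - Ric p u (f p (f p v))"
    by (simp add: star_ricci_def trace_f_K)
  then show ?thesis
    by (simp add: g_f_f f_f Ric_simps Ric_xi algebra_simps)
qed

text \<open>
  The contraction of \<open>D_xi_curvature\<close>. Smoothness of \<open>Ric(Y, Z)\<close> is a hypothesis because in the application
  it can be read off from the soliton equation.
\<close>

lemma dv_xi_Ric:
  assumes vf: "VF Y" "VF Z" and sm: "SF (\<lambda>q. Ric q (Y q) (Z q))"
  shows "dv \<xi> (\<lambda>q. Ric q (Y q) (Z q)) p = Ric p (D \<xi> Y p) (Z p) + Ric p (Y p) (D \<xi> Z p)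
    - 2 * \<beta> * Ric p (Y p) (Z p) - 4 * real n * \<beta>^3 * g p (Y p) (Z p)"
proof -
  define S where "S w = K p w (D \<xi> Y p) (Z p) + K p w (Y p) (D \<xi> Z p) - (2 * \<beta>) *\<^sub>R K p w (Y p) (Z p)
    - (2 * \<beta>^3) *\<^sub>R (g p (Y p) (Z p) *\<^sub>R w - g p w (Z p) *\<^sub>R Y p)" for w
  have tens: "tensor_11 A (\<lambda>q w. K q w (Y q) (Z q))"
    unfolding tensor_11_def
  proof (intro conjI allI impI K_linear)
    fix X assume X: "VF X"
    have "(\<lambda>p. K p (X p) (Y p) (Z p)) = R X Y Z" using R_pointwise[OF X vf] by auto
    then show "VF (\<lambda>p. K p (X p) (Y p) (Z p))" using R_vf[OF X vf] by simp
  qed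
  have "dv \<xi> (\<lambda>q. trace_endo (\<lambda>w. K q w (Y q) (Z q))) p = trace_endo S"
  proof (rule dv_trace[OF tens _ xi_vf])
    show "SF (\<lambda>q. trace_endo (\<lambda>w. K q w (Y q) (Z q)))" using sm by (simp add: ricci_def)
    fix X assume X: "VF X"
    have "(\<lambda>q. K q (X q) (Y q) (Z q)) = R X Y Z" using R_pointwise[OF X vf] by auto
    then show "D \<xi> (\<lambda>q. K q (X q) (Y q) (Z q)) p - K p (D \<xi> X p) (Y p) (Z p) = S (X p)"
      using X vf xi_vf by (simp add: D_xi_curvature R_pointwise D_vf S_def)
  qed
  then have "dv \<xi> (\<lambda>q. Ric q (Y q) (Z q)) p = trace_endo S" by (simp add: ricci_def)
  also have "\<dots> = Ric p (D \<xi> Y p) (Z p) + Ric p (Y p) (D \<xi> Z p)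
    - 2 * \<beta> * Ric p (Y p) (Z p) - (2 * \<beta>^3) * (g p (Y p) (Z p) * real DIM('e) - g p (Y p) (Z p))"
    unfolding S_def by (simp only: trace_endo_diff trace_endo_add trace_endo_scale trace_endo_id trace_endo_metric ricci_def)
  finally show ?thesis by (simp add: dim algebra_simps)
qed

end

section \<open>Solitons with potential field along \<open>\<xi>\<close>\<close>

locale collinear_soliton = weak_kenmotsu A g D n \<beta> f Q \<xi> \<eta>
  for A :: "('m::{t2_space, second_countable_topology}, 'e::euclidean_space) chart set"
    and g D n \<beta> f Q \<xi> \<eta> +
  fixes V :: "'m \<Rightarrow> 'e" and \<delta> :: "'m \<Rightarrow> real" and lam mu :: real
  assumes soliton: "star_eta_ricci_soliton A f \<eta> g D V lam mu"
    and delta_smooth: "smooth_function A \<delta>" and collinear: "V = (\<lambda>p. \<delta> p *\<^sub>R \<xi> p)"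
begin

text \<open>
  Half the Lie derivative is the symmetric part of \<open>\<nabla>V\<close>, and \<open>\<nabla>\<^sub>X (\<delta> \<xi>)\<close> is \<open>X(\<delta>) \<xi>\<close> plus \<open>\<delta> \<beta>\<close> times the
  projection of \<open>X\<close> to \<open>ker \<eta>\<close>.
\<close>

lemma half_lie_derivative:
  assumes vf: "VF X" "VF Y"
  shows "(1/2) * lie_derivative_metric A V g X Y p =
    (1/2) * (dv X \<delta> p * \<eta> p (Y p) + dv Y \<delta> p * \<eta> p (X p))
    + \<delta> p * \<beta> * (g p (X p) (Y p) - \<eta> p (X p) * \<eta> p (Y p))"
proof -
  have V: "VF V" using delta_smooth xi_vf by (simp add: collinear vector_field_scale)
  have DV: "D Z V p = dv Z \<delta> p *\<^sub>R \<xi> p + \<delta> p *\<^sub>R \<beta> *\<^sub>R (Z p - \<eta> p (Z p) *\<^sub>R \<xi> p)" if "VF Z" for Z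
    using that by (simp add: collinear D_scale delta_smooth xi_vf D_xi)
  have "lie_derivative_metric A V g X Y p = g p (D X V p) (Y p) + g p (X p) (D Y V p)"
    using vf V by (simp add: lie_derivative_metric_def dv_metric bracket_eq g_simps)
  then show ?thesis
    using vf by (simp add: DV g_simps g_xi algebra_simps)
qed

lemma soliton_at:
  "(1/2) * (differential A \<delta> p u * \<eta> p v + differential A \<delta> p v * \<eta> p u)
    + \<delta> p * \<beta> * (g p u v - \<eta> p u * \<eta> p v)
    + Ric p u (Q p v) + (2 * real n - 1) * \<beta>\<^sup>2 * g p u (Q p v) + \<beta>\<^sup>2 * \<eta> p u * \<eta> p v
    = lam * g p u v + mu * (\<eta> p u * \<eta> p v)"
proof -
  have e: "VF (extension A p u)" "VF (extension A p v)" by (simp_all add: extension)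
  have "(1/2) * lie_derivative_metric A V g (extension A p u) (extension A p v) p + star_ricci A D f p u v
      = lam * g p u v + mu * (\<eta> p u * \<eta> p v)"
    using soliton e unfolding star_eta_ricci_soliton_def by (metis extension(2))
  then show ?thesis
    unfolding half_lie_derivative[OF e] star_ricci_eq deriv_along_def extension(2) by linarith
qed

text \<open>
  The soliton equation with second argument \<open>\<xi>\<close>: the terms from \<open>Ric\<^sup>*\<close> add up to zero.
\<close>

lemma differential_delta: "differential A \<delta> p u = (lam + mu) * \<eta> p u"
proof -
  have *: "(1/2) * (differential A \<delta> p u + differential A \<delta> p (\<xi> p) * \<eta> p u) = (lam + mu) * \<eta> p u" for u
    using soliton_at[of p u "\<xi> p"] by (simp add: eta_xi g_xi Q_xi Ric_xi algebra_simps)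
  have "differential A \<delta> p (\<xi> p) = lam + mu" using *[of "\<xi> p"] by (simp add: eta_xi)
  then show ?thesis using *[of u] by simp
qed

lemma Ric_Q: "Ric p u (Q p v) = (lam - \<delta> p * \<beta>) * (g p u v - \<eta> p u * \<eta> p v)
    - (2 * real n - 1) * \<beta>\<^sup>2 * g p u (Q p v) - \<beta>\<^sup>2 * (\<eta> p u * \<eta> p v)"
  using soliton_at[of p u v] by (simp add: differential_delta algebra_simps)

lemma dv_xi_simps:
  assumes vf: "VF X" "VF Y"
  shows "dv \<xi> (\<lambda>q. \<eta> q (X q)) p = \<eta> p (D \<xi> X p)"
    and "dv \<xi> (\<lambda>q. g q (X q) (Y q)) p = g p (D \<xi> X p) (Y p) + g p (X p) (D \<xi> Y p)"
    and "dv \<xi> (\<lambda>q. g q (X q) (Q q (Y q))) p = g p (D \<xi> X p) (Q p (Y p)) + g p (X p) (Q p (D \<xi> Y p))"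
    and "dv \<xi> \<delta> p = lam + mu"
  using vf by (simp_all add: dv_eta dv_metric xi_vf Q_vf D_xi_Q g_xi eta_xi)
    (simp add: deriv_along_def differential_delta eta_xi)

text \<open>
  The derivative of \<open>Ric(X, Q Y)\<close> along \<open>\<xi>\<close> is computed once by the contracted Bianchi identity and once from
  \<open>Ric_Q\<close>, where only \<open>\<delta>\<close> contributes beyond the terms with \<open>\<nabla>\<^sub>\<xi> X\<close> and \<open>\<nabla>\<^sub>\<xi> Y\<close>. The coefficient of
  \<open>Q\<close> in the two results differs, so \<open>Q\<close> can be solved for.
\<close>

lemma Q_from_soliton: "2 * \<beta>\<^sup>2 * g p u (Q p v) =
    (lam + mu - 2 * lam + 2 * \<delta> p * \<beta>) * (g p u v - \<eta> p u * \<eta> p v) + 2 * \<beta>\<^sup>2 * (\<eta> p u * \<eta> p v)"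
proof -
  define X Y where "X = extension A p u" and "Y = extension A p v"
  have vf: "VF X" "VF Y" and at: "X p = u" "Y p = v" by (simp_all add: X_def Y_def extension)
  have sm: "SF (\<lambda>q. \<eta> q (X q))" "SF (\<lambda>q. \<eta> q (Y q))" "SF (\<lambda>q. g q (X q) (Y q))" "SF (\<lambda>q. g q (X q) (Q q (Y q)))"
    using vf by (simp_all add: eta_smooth g_smooth Q_vf)
  note smooths = sm delta_smooth smooth_function_const smooth_function_mult smooth_function_diff
  have eq: "(\<lambda>q. Ric q (X q) (Q q (Y q))) = (\<lambda>q. (lam - \<delta> q * \<beta>) * (g q (X q) (Y q) - \<eta> q (X q) * \<eta> q (Y q))
    - (2 * real n - 1) * \<beta>\<^sup>2 * g q (X q) (Q q (Y q)) - \<beta>\<^sup>2 * (\<eta> q (X q) * \<eta> q (Y q)))"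
    by (simp add: Ric_Q)
  have "SF (\<lambda>q. Ric q (X q) (Q q (Y q)))"
    unfolding eq by (intro smooths)
  from dv_xi_Ric[OF vf(1) Q_vf[OF vf(2)] this, of p]
  have "dv \<xi> (\<lambda>q. Ric q (X q) (Q q (Y q))) p = Ric p (D \<xi> X p) (Q p v) + Ric p u (Q p (D \<xi> Y p))
    - 2 * \<beta> * Ric p u (Q p v) - 4 * real n * \<beta>^3 * g p u (Q p v)"
    using vf by (simp add: D_xi_Q at)
  moreover have "dv \<xi> (\<lambda>q. Ric q (X q) (Q q (Y q))) p = Ric p (D \<xi> X p) (Q p v) + Ric p u (Q p (D \<xi> Y p))
    - \<beta> * (lam + mu) * (g p u v - \<eta> p u * \<eta> p v)"
    unfolding eq
    by (simp only: dv_diff dv_mult dv_const dv_xi_simps[OF vf] dv_xi_simps(1)[OF vf(2,1)] smooths) (simp add: at Ric_Q algebra_simps)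
  ultimately have "\<beta> * (2 * Ric p u (Q p v) + 4 * real n * \<beta>\<^sup>2 * g p u (Q p v)) = \<beta> * ((lam + mu) * (g p u v - \<eta> p u * \<eta> p v))"
    by (simp add: algebra_simps power2_eq_square power3_eq_cube)
  then have "2 * Ric p u (Q p v) + 4 * real n * \<beta>\<^sup>2 * g p u (Q p v) = (lam + mu) * (g p u v - \<eta> p u * \<eta> p v)"
    using beta_nonzero by simp
  then show ?thesis unfolding Ric_Q by (simp add: algebra_simps)
qed

text \<open>
  Along \<open>\<xi>\<close> the tensor \<open>g(\<cdot>, Q \<cdot>)\<close> is parallel, so the factor by which \<open>Q\<close> acts on \<open>ker \<eta>\<close> has derivative zero, and
  this derivative is a nonzero multiple of \<open>\<xi>(\<delta>) = \<lambda> + \<mu>\<close>. A nonzero vector in \<open>ker \<eta>\<close> exists since \<open>f\<close> has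
  rank \<open>2 n > 0\<close> and image in \<open>ker \<eta>\<close>.
\<close>

lemma lam_plus_mu_zero: "lam + mu = 0"
proof -
  fix p :: 'm
  have "\<exists>v. f p v \<noteq> 0"
  proof (rule ccontr)
    assume "\<not> ?thesis"
    then have "range (f p) = {0}" by auto
    then show False using rank_f[of p] n_pos by simp
  qed
  then obtain u where u: "u \<noteq> 0" "\<eta> p u = 0" using eta_f by blast
  define X where "X = extension A p u"
  have vf: "VF X" and at: "X p = u" by (simp_all add: X_def extension)
  have sm: "SF (\<lambda>q. \<eta> q (X q))" "SF (\<lambda>q. g q (X q) (X q))" "SF (\<lambda>q. g q (X q) (Q q (X q)))"
    using vf by (simp_all add: eta_smooth g_smooth Q_vf)
  note smooths = sm delta_smooth smooth_function_const smooth_function_mult smooth_function_diff smooth_function_add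
  have "(\<lambda>q. 2 * \<beta>\<^sup>2 * g q (X q) (Q q (X q))) = (\<lambda>q. (lam + mu - 2 * lam + 2 * \<delta> q * \<beta>) * (g q (X q) (X q) - \<eta> q (X q) * \<eta> q (X q)) + 2 * \<beta>\<^sup>2 * (\<eta> q (X q) * \<eta> q (X q)))"
    by (rule ext, rule Q_from_soliton)
  then have "dv \<xi> (\<lambda>q. 2 * \<beta>\<^sup>2 * g q (X q) (Q q (X q))) p = dv \<xi> (\<lambda>q. (lam + mu - 2 * lam + 2 * \<delta> q * \<beta>) * (g q (X q) (X q) - \<eta> q (X q) * \<eta> q (X q)) + 2 * \<beta>\<^sup>2 * (\<eta> q (X q) * \<eta> q (X q))) p"
    by (rule arg_cong[where f = "\<lambda>h. dv \<xi> h p"])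
  then have "2 * \<beta>\<^sup>2 * g p (D \<xi> X p) (Q p u) + 2 * \<beta>\<^sup>2 * g p u (Q p (D \<xi> X p)) =
      2 * \<beta> * (lam + mu) * g p u u + (lam + mu - 2 * lam + 2 * \<delta> p * \<beta>) * (g p (D \<xi> X p) u + g p u (D \<xi> X p))"
    by (simp only: dv_add dv_diff dv_mult dv_const dv_xi_simps[OF vf vf] smooths) (simp add: at u algebra_simps)
  then have "2 * \<beta> * (lam + mu) * g p u u = 0"
    unfolding Q_from_soliton by (simp add: u algebra_simps)
  then show ?thesis using beta_nonzero g_pos[OF u(1), of p] by simp
qed

lemma Ric_eq: "Ric p u v = - 2 * real n * \<beta>\<^sup>2 * g p u v"
proof -
  obtain w where w: "v = Q p w" using Q_bij by (metis bij_pointE)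
  show ?thesis
    using Q_from_soliton[of p u w] Ric_Q[of p u w] lam_plus_mu_zero by (simp add: w algebra_simps)
qed

lemma delta_constant: "\<exists>c. \<forall>p. \<delta> p = c"
  by (rule constant_if_differential_zero[OF connected_UNIV delta_smooth])
     (simp add: differential_delta lam_plus_mu_zero)

lemma scalar_curvature_eq: "scalar_curvature A g D p = - 2 * real n * (2 * real n + 1) * \<beta>\<^sup>2"
proof -
  let ?k = "- 2 * real n * \<beta>\<^sup>2"
  have "(THE S. linear S \<and> (\<forall>u v. g p (S u) v = Ric p u v)) = (\<lambda>u. ?k *\<^sub>R u)"
  proof (rule the_equality)
    show "linear (\<lambda>u. ?k *\<^sub>R u) \<and> (\<forall>u v. g p (?k *\<^sub>R u) v = Ric p u v)"
      by (auto simp: g_simps Ric_eq intro!: linearI simp: algebra_simps)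
    fix S assume S: "linear S \<and> (\<forall>u v. g p (S u) v = Ric p u v)"
    show "S = (\<lambda>u. ?k *\<^sub>R u)"
      by (rule ext, rule g_eqI[of p]) (use S in \<open>simp add: g_simps Ric_eq\<close>)
  qed
  then have "scalar_curvature A g D p = trace_endo (\<lambda>u::'e. ?k *\<^sub>R u)"
    by (simp add: scalar_curvature_def metric_trace_def)
  also have "\<dots> = ?k * (2 * real n + 1)"
    by (simp only: trace_endo_scale trace_endo_id dim) simp
  finally show ?thesis by (simp add: algebra_simps)
qed

end

theorem theorem4:
  fixes A :: "('m::{t2_space, second_countable_topology}, 'e::euclidean_space) chart set"
    and f Q :: "'m \<Rightarrow> 'e \<Rightarrow> 'e"
    and \<xi> V :: "'m \<Rightarrow> 'e"
    and \<eta> :: "'m \<Rightarrow> 'e \<Rightarrow> real"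
    and g :: "'m \<Rightarrow> 'e \<Rightarrow> 'e \<Rightarrow> real"
    and D :: "('m \<Rightarrow> 'e) \<Rightarrow> ('m \<Rightarrow> 'e) \<Rightarrow> 'm \<Rightarrow> 'e"
    and \<delta> :: "'m \<Rightarrow> real"
    and n :: nat
    and \<beta> lam mu :: real
  assumes "weak_beta_kenmotsu n \<beta> A f Q \<xi> \<eta> g D"
    and "star_eta_ricci_soliton A f \<eta> g D V lam mu"
    and "smooth_function A \<delta>"
    and "\<delta> \<noteq> (\<lambda>p. 0)"
    and "V = (\<lambda>p. \<delta> p *\<^sub>R \<xi> p)"
  shows "(\<exists>c. \<forall>p. \<delta> p = c) \<and> einstein A g D \<and>
         (\<forall>p. scalar_curvature A g D p = - 2 * real n * (2 * real n + 1) * \<beta>^2)"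
proof -
  interpret collinear_soliton A g D n \<beta> f Q \<xi> \<eta> V \<delta> lam mu
    using assms
    by unfold_locales (simp_all add: weak_beta_kenmotsu_def weak_almost_contact_metric_def connected_manifold_def)
  show ?thesis
    unfolding einstein_def using delta_constant Ric_eq scalar_curvature_eq by blast
qed

end
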